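(* Let $\Phi$ be an irreducible crystallographic root system with positive system $\Phi^+$, let $k$ be a positive integer, let $R$ be a dominant region of the $k$-Catalan arrangement of $\Phi$, let $\mathcal{I}=\theta(R)$, and let $\alpha\in\Phi^+$. Then $R$ contains an alcove $B$ such that for all $r\in\{1,\ldots,k\}$ the following are equivalent: (1) $H_\alpha^r$ is a ceiling of $R$; (2) $\alpha$ is a rank $r$ indecomposable element of $\mathcal{I}$; (3) $H_\alpha^r$ is a ceiling of $B$.
   Context: $\Phi$ lives in a real Euclidean space $V$ with inner product $\langle\cdot,\cdot\rangle$, simple system $S$. $H_\alpha^r=\{x\in V\mid\langle x,\alpha\rangle=r\}$. The $k$-Catalan arrangement consists of the $H_\alpha^r$ with $\alpha\in\Phi$, $r\in\{0,\ldots,k\}$; regions are connected components of its complement; $R$ is dominant if $\langle x,\alpha\rangle>0$ for all $\alpha\in\Phi^+$, $x\in R$. Walls of a region (or alcove) are hyperplanes of the relevant arrangement supporting a facet of it; a ceiling is a wall not containing the origin such that the origin is on the same side of it as the region. The affine Coxeter arrangement consists of all $H_\alpha^r$ with $\alpha\in\Phi$, $r\in\mathbb{Z}$; alcoves are the connected components of its complement, and a ceiling of an alcove $B$ is a hyperplane of the affine Coxeter arrangement supporting a facet of $B$, not containing the origin, with the origin on the same side as $B$. The root poset is $\Phi^+$ with $\alpha\le\beta$ iff $\beta-\alpha$ is a nonnegative integer combination of $S$; an ideal is a down-closed subset. For a dominant region $R$, $\theta(R)=(I_1,\ldots,I_k)$ with $I_i=\{\alpha\in\Phi^+\mid\langle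 x,\alpha\rangle<i\text{ for all }x\in R\}$ (an ascending chain of ideals). For a chain $\mathcal{I}=(I_1,\ldots,I_K)$ of ideals and $\alpha\in\Phi^+$, $r_\alpha(\mathcal{I})=\min\{r_1+\cdots+r_m\mid \alpha=\alpha_1+\cdots+\alpha_m,\ \alpha_i\in I_{r_i},\ r_i\in\{1,\ldots,K\}\}$, and $r_\alpha(\mathcal{I})=\infty$ if no such decomposition exists. Setting $I_0=\varnothing$, an element $\alpha\in\Phi^+$ is a rank $r$ indecomposable element of $\mathcal{I}$ if $\alpha\in I_r$ and (i) $r_\alpha(\mathcal{I})=r$; (ii) $\alpha\notin I_i+I_j=\{\beta+\gamma\mid\beta\in I_i,\gamma\in I_j\}$ whenever $i+j=r$; (iii) whenever $\beta\in\Phi^+$ and $r_{\alpha+\beta}(\mathcal{I})=t\le K$, then $\beta\in I_{t-r}$. *)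

theory Defs
  imports "HOL-Analysis.Analysis" "HOL-Library.Extended_Nat"
begin

definition refl_vec :: "'a::euclidean_space \<Rightarrow> 'a \<Rightarrow> 'a" where
  "refl_vec a x = x - (2 * (x \<bullet> a) / (a \<bullet> a)) *\<^sub>R a"

definition root_system :: "'a::euclidean_space set \<Rightarrow> bool" where
  "root_system Phi \<longleftrightarrow> finite Phi \<and> 0 \<notin> Phi \<and> span Phi = UNIV \<and>
     (\<forall>a\<in>Phi. refl_vec a ` Phi = Phi) \<and>
     (\<forall>a\<in>Phi. \<forall>c::real. c *\<^sub>R a \<in> Phi \<longrightarrow> c = 1 \<or> c = -1)"

definition crystallographic :: "'a::euclidean_space set \<Rightarrow> bool" where
  "crystallographic Phi \<longleftrightarrow> (\<forall>a\<in>Phi. \<forall>b\<in>Phi. 2 * (b \<bullet> a) / (a \<bullet> a) \<in> \<int>)"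

definition irreducible_rs :: "'a::euclidean_space set \<Rightarrow> bool" where
  "irreducible_rs Phi \<longleftrightarrow> \<not> (\<exists>A B. A \<noteq> {} \<and> B \<noteq> {} \<and> A \<union> B = Phi \<and> A \<inter> B = {} \<and>
       (\<forall>a\<in>A. \<forall>b\<in>B. a \<bullet> b = 0))"

definition nn_int_comb :: "'a::euclidean_space set \<Rightarrow> 'a \<Rightarrow> bool" where
  "nn_int_comb S x \<longleftrightarrow> (\<exists>c. (\<forall>s\<in>S. c s \<in> \<nat>) \<and> x = (\<Sum>s\<in>S. c s *\<^sub>R s))"

definition simple_system :: "'a::euclidean_space set \<Rightarrow> 'a set \<Rightarrow> bool" where
  "simple_system Phi S \<longleftrightarrow> S \<subseteq> Phi \<and> independent S \<and>
     (\<forall>a\<in>Phi. nn_int_comb S a \<or> nn_int_comb S (- a))"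

definition pos_roots :: "'a::euclidean_space set \<Rightarrow> 'a set \<Rightarrow> 'a set" where
  "pos_roots Phi S = {a\<in>Phi. nn_int_comb S a}"

definition hyp :: "'a::euclidean_space \<Rightarrow> real \<Rightarrow> 'a set" where
  "hyp a r = {x. x \<bullet> a = r}"

definition catalan_arr :: "'a::euclidean_space set \<Rightarrow> nat \<Rightarrow> 'a set set" where
  "catalan_arr Phi k = {hyp a (real r) | a r. a \<in> Phi \<and> r \<le> k}"

definition affine_arr :: "'a::euclidean_space set \<Rightarrow> 'a set set" where
  "affine_arr Phi = {hyp a (real_of_int r) | a r. a \<in> Phi}"

definition regions :: "'a::euclidean_space set set \<Rightarrow> 'a set set" where
  "regions A = components (UNIV - \<Union>A)"

definition dominant :: "'a::euclidean_space set \<Rightarrow> 'a set \<Rightarrow> bool" where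
  "dominant PhiP R \<longleftrightarrow> (\<forall>x\<in>R. \<forall>a\<in>PhiP. x \<bullet> a > 0)"

definition wall :: "'a::euclidean_space set set \<Rightarrow> 'a set \<Rightarrow> 'a set \<Rightarrow> bool" where
  "wall A R H \<longleftrightarrow> H \<in> A \<and> (H \<inter> closure R) facet_of (closure R)"

definition ceiling :: "'a::euclidean_space set set \<Rightarrow> 'a set \<Rightarrow> 'a set \<Rightarrow> bool" where
  "ceiling A R H \<longleftrightarrow> wall A R H \<and> 0 \<notin> H \<and> (\<forall>x\<in>R. closed_segment 0 x \<inter> H = {})"

definition theta :: "'a::euclidean_space set \<Rightarrow> 'a set \<Rightarrow> nat \<Rightarrow> 'a set" where
  "theta PhiP R i = {a\<in>PhiP. \<forall>x\<in>R. x \<bullet> a < real i}"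

text \<open>Chain I_1,...,I_K given as a function; index 0 (and anything below) is the empty set.\<close>
definition chainI :: "(nat \<Rightarrow> 'a set) \<Rightarrow> nat \<Rightarrow> 'a set" where
  "chainI I i = (if i = 0 then {} else I i)"

definition rk :: "(nat \<Rightarrow> 'a::euclidean_space set) \<Rightarrow> nat \<Rightarrow> 'a \<Rightarrow> enat" where
  "rk I K a = Inf {enat (sum_list (map snd ds)) | ds.
       ds \<noteq> [] \<and> (\<forall>(b, r)\<in>set ds. r \<in> {1..K} \<and> b \<in> I r) \<and> sum_list (map fst ds) = a}"

definition indecomposable ::
  "'a::euclidean_space set \<Rightarrow> (nat \<Rightarrow> 'a set) \<Rightarrow> nat \<Rightarrow> nat \<Rightarrow> 'a \<Rightarrow> bool" where
  "indecomposable PhiP I K r a \<longleftrightarrow> a \<in> chainI I r \<and>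
     rk I K a = enat r \<and>
     (\<forall>i j. i + j = r \<longrightarrow> a \<notin> {b + c | b c. b \<in> chainI I i \<and> c \<in> chainI I j}) \<and>
     (\<forall>b\<in>PhiP. \<forall>t. a + b \<in> PhiP \<and> rk I K (a + b) = enat t \<and> t \<le> K \<longrightarrow> b \<in> chainI I (t - r))"

end

(* A facet of R (or of an alcove in R) on the hyperplane \<alpha> = r contains a point y on no other
   hyperplane of the arrangement; evaluating at y shows that \<alpha> is indecomposable of rank r.

   Conversely, if \<alpha> = r supports no facet of R then, by Farkas' lemma, r - \<alpha> is a nonnegative
   combination of a constant and the other affine forms i - b and g - m that are positive on R and
   have level at most k. Simultaneous Diophantine approximation and the integrality of root pairings
   make the coefficients integers after multiplying by some N > 0. Repeatedly merging i - b with
   g - m when <b, g> > 0, and cancelling r - \<alpha> against i - b when <\<alpha>, b> > 0, keeps all levels at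
   most k by indecomposability. When neither is possible, N \<alpha> + sum of the g's = sum of the b's has
   nonpositive square norm, which is absurd.

   The Farkas argument yields a point on the hyperplane near which R is a half ball. A generic
   nearby point of the hyperplane determines the alcove B; as \<alpha> has only one possible rank, this B
   serves all r at once. *)
theory Submission
  imports Defs "HOL-Library.Multiset"
begin

section \<open>Roots and rank\<close>

lemma root_uminus:
  assumes "root_system Phi" "a \<in> Phi" shows "- a \<in> Phi"
proof -
  have "refl_vec a ` Phi = Phi" "a \<noteq> 0" using assms by (auto simp: root_system_def)
  moreover have "refl_vec a a = - a"
    using \<open>a \<noteq> 0\<close> by (simp add: refl_vec_def scaleR_2)
  ultimately show ?thesis using assms(2) by (metis imageI)
qed

text \<open>Equality in Cauchy-Schwarz kills the component of \<open>a\<close> orthogonal to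
  \<open>b\<close>, and the only roots on the line of \<open>b\<close> are \<open>b\<close> and
  \<open>- b\<close>.\<close>

lemma root_parallel:
  assumes "root_system Phi" "a \<in> Phi" "b \<in> Phi" "(a \<bullet> b)\<^sup>2 = (a \<bullet> a) * (b \<bullet> b)"
  shows "a = b \<or> a = - b"
proof -
  have nz: "a \<noteq> 0" "b \<noteq> 0" using assms(1-3) by (auto simp: root_system_def)
  define c where "c = (a \<bullet> b) / (b \<bullet> b)"
  have "(a - c *\<^sub>R b) \<bullet> (a - c *\<^sub>R b) = 0"
    using assms(4) nz by (simp add: c_def algebra_simps inner_commute power2_eq_square divide_simps)
  then have "a = c *\<^sub>R b" by simp
  moreover have "c = 1 \<or> c = -1"
    using assms(1-3) \<open>a = c *\<^sub>R b\<close> unfolding root_system_def by metis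
  ultimately show ?thesis by auto
qed

text \<open>Both Cartan integers are positive, and strict Cauchy-Schwarz bounds their product below
  4, so one of them is 1. The corresponding reflection produces \<open>a - b\<close> or its
  negative.\<close>

lemma root_diff:
  assumes rs: "root_system Phi" and cr: "crystallographic Phi"
    and a: "a \<in> Phi" and b: "b \<in> Phi" and "a \<noteq> b" and pos: "a \<bullet> b > 0"
  shows "a - b \<in> Phi"
proof -
  have nz: "a \<noteq> 0" "b \<noteq> 0" using rs a b by (auto simp: root_system_def)
  have "a \<noteq> - b"
  proof
    assume "a = - b"
    then have "a \<bullet> b = - (b \<bullet> b)" by simp
    then show False using pos inner_ge_zero[of b] by linarith
  qed
  then have "(a \<bullet> b)\<^sup>2 \<noteq> (a \<bullet> a) * (b \<bullet> b)"
    using root_parallel[OF rs a b] \<open>a \<noteq> b\<close> by blast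
  then have strict: "(a \<bullet> b)\<^sup>2 < (a \<bullet> a) * (b \<bullet> b)"
    using Cauchy_Schwarz_ineq[of a b] by linarith
  obtain m n :: int where m: "2 * (a \<bullet> b) / (b \<bullet> b) = of_int m" and n: "2 * (b \<bullet> a) / (a \<bullet> a) = of_int n"
    using cr a b unfolding crystallographic_def by (meson Ints_cases)
  have "real_of_int (m * n) = 4 * (a \<bullet> b)\<^sup>2 / ((a \<bullet> a) * (b \<bullet> b))"
    unfolding of_int_mult m[symmetric] n[symmetric] by (simp add: inner_commute power2_eq_square)
  also have "\<dots> < 4" using strict nz by (simp add: divide_less_eq)
  finally have mn: "m * n < 4" by linarith
  have "real_of_int m > 0" "real_of_int n > 0"
    unfolding m[symmetric] n[symmetric] using pos nz by (auto simp: inner_commute)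
  then have "m \<ge> 1" "n \<ge> 1" by auto
  have "m = 1 \<or> n = 1"
  proof (rule ccontr)
    assume "\<not> ?thesis"
    then have "2 \<le> m" "2 \<le> n" using \<open>m \<ge> 1\<close> \<open>n \<ge> 1\<close> by auto
    then have "2 * 2 \<le> m * n" by (intro mult_mono) auto
    then show False using mn by simp
  qed
  then show ?thesis
  proof
    assume "m = 1"
    then have "refl_vec b a = a - b" unfolding refl_vec_def m by simp
    then show ?thesis using rs a b unfolding root_system_def by (metis imageI)
  next
    assume "n = 1"
    then have "refl_vec a b = b - a" unfolding refl_vec_def n by simp
    then have "b - a \<in> Phi" using rs a b unfolding root_system_def by (metis imageI)
    then show ?thesis using root_uminus[OF rs] by fastforce
  qed
qed

lemma rk_le: "b \<in> I i \<Longrightarrow> i \<in> {1..K} \<Longrightarrow> rk I K b \<le> enat i"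
  unfolding rk_def by (rule Inf_lower) (auto intro!: exI[of _ "[(b, i)]"])

text \<open>A finite infimum in \<open>enat\<close> comes from a nonempty set, and well-ordering
  makes it a minimum.\<close>

lemma rk_attained:
  assumes "rk I K a = enat t"
  obtains ds where "ds \<noteq> []" "\<forall>(b, r)\<in>set ds. r \<in> {1..K} \<and> b \<in> I r"
    "sum_list (map fst ds) = a" "sum_list (map snd ds) = t"
proof -
  let ?X = "{enat (sum_list (map snd ds)) | ds.
       ds \<noteq> [] \<and> (\<forall>(b, r)\<in>set ds. r \<in> {1..K} \<and> b \<in> I r) \<and> sum_list (map fst ds) = a}"
  have eq: "Inf ?X = enat t" using assms unfolding rk_def .
  then have "?X \<noteq> {}" by (metis (no_types, lifting) Inf_empty enat.distinct(1) top_enat_def)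
  then have "Inf ?X \<in> ?X" unfolding Inf_enat_def by (auto intro: LeastI)
  then show ?thesis unfolding eq using that by auto
qed

section \<open>Sums over multisets\<close>

lemma inner_sum_mset:
  fixes x :: "'a::real_inner"
  shows "x \<bullet> (\<Sum>p\<in>#M. f p) = (\<Sum>p\<in>#M. x \<bullet> f p)"
  by (induction M) (auto simp: inner_right_distrib)

lemma sum_mset_nonpos:
  fixes f :: "'b \<Rightarrow> real"
  shows "(\<And>p. p \<in># M \<Longrightarrow> f p \<le> 0) \<Longrightarrow> (\<Sum>p\<in>#M. f p) \<le> 0"
  by (induction M) (auto simp: add_nonpos_nonpos)

lemma sum_mset_sum_replicate_nat:
  fixes f :: "'b \<Rightarrow> nat"
  assumes "finite J"
  shows "(\<Sum>p\<in>#(\<Sum>j\<in>J. replicate_mset (n j) j). f p) = (\<Sum>j\<in>J. n j * f j)"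
  using assms by (induction J rule: finite_induct) auto

lemma in_sum_replicate:
  assumes "finite J" "x \<in># (\<Sum>j\<in>J. replicate_mset (n j) j)"
  shows "x \<in> J"
  using assms by (induction J rule: finite_induct) (auto split: if_splits)

section \<open>Facets and convex sets avoiding hyperplanes\<close>

text \<open>Induction on \<open>J\<close>: join a point \<open>p\<close> off the old hyperplanes to
  a point \<open>q\<close> off the new one. Each hyperplane misses an endpoint, so it meets the
  segment for at most one parameter, and infinitely many parameters are available.\<close>

lemma convex_avoid_hyperplanes:
  fixes F :: "'a::euclidean_space set"
  assumes "finite J" "convex F" "F \<noteq> {}" "\<And>b c. (b, c) \<in> J \<Longrightarrow> \<not> F \<subseteq> hyp b c"
  shows "\<exists>p\<in>F. \<forall>(b, c)\<in>J. p \<notin> hyp b c"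
  using assms(1,4)
proof (induction J)
  case empty
  then show ?case using assms(3) by auto
next
  case (insert j J)
  obtain b0 c0 where j: "j = (b0, c0)" by force
  obtain p where p: "p \<in> F" "\<forall>(b, c)\<in>J. p \<notin> hyp b c" using insert by auto
  obtain q where q: "q \<in> F" "q \<notin> hyp b0 c0" using insert.prems[of b0 c0] j by auto
  define z where "z t = (1 - t) *\<^sub>R p + t *\<^sub>R q" for t :: real
  have lin: "z t \<bullet> b = p \<bullet> b + t * (q \<bullet> b - p \<bullet> b)" for t b
    by (simp add: z_def algebra_simps)
  define bad where "bad = (\<lambda>(b, c). {t. z t \<in> hyp b c})"
  have fin: "finite (bad e)" if "e \<in> insert j J" for e
  proof -
    obtain b c where e: "e = (b, c)" by force
    have "t = t'" if "t \<in> bad e" "t' \<in> bad e" for t t'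
    proof -
      have 1: "p \<bullet> b + t * (q \<bullet> b - p \<bullet> b) = c" "p \<bullet> b + t' * (q \<bullet> b - p \<bullet> b) = c"
        using that lin by (auto simp: bad_def e hyp_def)
      have "p \<bullet> b \<noteq> c \<or> q \<bullet> b \<noteq> c"
        using \<open>e \<in> insert j J\<close> p(2) q(2) e j by (auto simp: hyp_def)
      then have "q \<bullet> b - p \<bullet> b \<noteq> 0" using 1 by auto
      then show ?thesis using 1 by (metis add_left_cancel mult_right_cancel)
    qed
    then have "bad e \<subseteq> {SOME t. t \<in> bad e}" by (metis singletonI someI subsetI)
    then show ?thesis using finite_subset by blast
  qed
  have "finite (\<Union>e\<in>insert j J. bad e)" using insert.hyps fin by blast
  moreover have "infinite {0..1::real}" by (simp add: infinite_Icc)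
  ultimately obtain t where t: "t \<in> {0..1}" "t \<notin> (\<Union>e\<in>insert j J. bad e)"
    by (meson finite_subset subsetI)
  have "z t \<in> F" unfolding z_def using assms(2) p(1) q(1) t(1) by (auto simp: convex_alt)
  moreover have "\<forall>(b, c)\<in>insert j J. z t \<notin> hyp b c" using t(2) by (fastforce simp: bad_def)
  ultimately show ?case by blast
qed

text \<open>Dirichlet's simultaneous approximation, transported from an initial segment of the
  naturals to the index set \<open>J\<close>.\<close>

lemma simultaneous_approx:
  assumes "finite J" "e > 0"
  obtains q :: nat and p :: "'b \<Rightarrow> int"
  where "q > 0" "\<And>j. j \<in> J \<Longrightarrow> \<bar>real q * c j - of_int (p j)\<bar> < e"
proof -
  obtain f where f: "bij_betw f {0..<card J} J" using ex_bij_betw_nat_finite[OF assms(1)] by blast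
  obtain N where N: "N > 0" "1 / real N < e"
    using assms(2) by (metis nat_approx_posE zero_less_Suc)
  obtain q p where q: "0 < q" "\<And>i. i < card J \<Longrightarrow> \<bar>of_int q * c (f i) - of_int (p i)\<bar> < 1 / real N"
    using Dirichlet_approx_simult[OF N(1), of "card J" "\<lambda>i. c (f i)"] by metis
  have "\<bar>real (nat q) * c j - of_int (p (the_inv_into {0..<card J} f j))\<bar> < e" if "j \<in> J" for j
  proof -
    have "j \<in> f ` {0..<card J}" using that bij_betw_imp_surj_on[OF f] by simp
    then obtain i where "i < card J" "j = f i" by auto
    moreover have "the_inv_into {0..<card J} f (f i) = i"
      using f \<open>i < card J\<close> by (auto simp: bij_betw_def intro!: the_inv_into_f_f)
    ultimately show ?thesis using q(1) q(2)[of i] N(2) by (simp add: of_nat_nat)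
  qed
  then show ?thesis using that[of "nat q" "\<lambda>j. p (the_inv_into {0..<card J} f j)"] q(1) by simp
qed

text \<open>The nonnegative combinations form a convex cone containing the generators. Indexing by
  \<open>J\<close> instead of by the image ties each coefficient to its index even if
  \<open>f\<close> is not injective.\<close>

lemma convex_cone_hull_finite_image:
  fixes f :: "'b \<Rightarrow> 'a::real_vector"
  assumes "finite J" "v \<in> convex_cone hull (f ` J)"
  obtains c where "\<And>j. c j \<ge> 0" "v = (\<Sum>j\<in>J. c j *\<^sub>R f j)"
proof -
  define D where "D = {\<Sum>j\<in>J. c j *\<^sub>R f j | c. \<forall>j. c j \<ge> 0}"
  have "convex_cone D"
    unfolding convex_cone_iff
  proof (intro conjI ballI allI impI)
    show "0 \<in> D" unfolding D_def by (auto intro!: exI[of _ "\<lambda>_. 0"])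
  next
    fix x y assume "x \<in> D" "y \<in> D"
    then obtain c d where "x = (\<Sum>j\<in>J. c j *\<^sub>R f j)" "y = (\<Sum>j\<in>J. d j *\<^sub>R f j)" "\<forall>j. c j \<ge> 0" "\<forall>j. d j \<ge> 0"
      unfolding D_def by auto
    then show "x + y \<in> D" unfolding D_def
      by (auto intro!: exI[of _ "\<lambda>j. c j + d j"] simp: sum.distrib scaleR_left_distrib)
  next
    fix x and a :: real assume "x \<in> D" "0 \<le> a"
    then obtain c where "x = (\<Sum>j\<in>J. c j *\<^sub>R f j)" "\<forall>j. c j \<ge> 0" unfolding D_def by auto
    then show "a *\<^sub>R x \<in> D" unfolding D_def using \<open>0 \<le> a\<close>
      by (auto intro!: exI[of _ "\<lambda>j. a * c j"] simp: scaleR_sum_right)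
  qed
  moreover have "f ` J \<subseteq> D"
  proof
    fix x assume "x \<in> f ` J"
    then obtain j where j: "j \<in> J" "x = f j" by blast
    then have "x = (\<Sum>i\<in>J. (if i = j then 1 else 0) *\<^sub>R f i)" using assms(1)
      by (simp add: if_distrib[of "\<lambda>c. c *\<^sub>R _"] sum.delta cong: if_cong)
    then show "x \<in> D" unfolding D_def by (auto intro!: exI[of _ "\<lambda>i. if i = j then 1 else 0"])
  qed
  ultimately have "convex_cone hull (f ` J) \<subseteq> D" by (simp add: hull_minimal)
  then show ?thesis using assms that unfolding D_def by blast
qed

lemma sum_mset_sum_replicate:
  fixes f :: "'b \<Rightarrow> 'a::real_vector"
  assumes "finite J"
  shows "(\<Sum>p\<in>#(\<Sum>j\<in>J. replicate_mset (n j) j). f p) = (\<Sum>j\<in>J. real (n j) *\<^sub>R f j)"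
proof -
  have "(\<Sum>p\<in>#replicate_mset m j. f p) = real m *\<^sub>R f j" for m j
    by (induction m) (auto simp: scaleR_left_distrib)
  with assms show ?thesis by (induction J rule: finite_induct) auto
qed

text \<open>A subset of codimension 1 affinely spans \<open>hyp a r\<close>, so all of
  \<open>hyp a r\<close> lies in \<open>hyp b c\<close>. The conclusion is equality in
  Cauchy-Schwarz, the form that \<open>root_parallel\<close> takes as input.\<close>

lemma parallel_hyperplanes:
  fixes F :: "'a::euclidean_space set"
  assumes "a \<noteq> 0" "F \<subseteq> hyp a r" "F \<subseteq> hyp b c" "aff_dim F = int DIM('a) - 1" "F \<noteq> {}"
  shows "(b \<bullet> a)\<^sup>2 = (b \<bullet> b) * (a \<bullet> a)"
proof -
  have hyp: "hyp a r = {x. a \<bullet> x = r}" "hyp b c = {x. b \<bullet> x = c}" for a r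
    by (auto simp: hyp_def inner_commute)
  have "affine hull F = hyp a r"
  proof (rule affine_dim_equal)
    show "affine hull F \<subseteq> hyp a r" using assms(2) by (simp add: hull_minimal affine_hyperplane hyp)
    show "aff_dim (affine hull F) = aff_dim (hyp a r)" using assms(1,4) by (simp add: hyp)
  qed (use assms in \<open>auto simp: hyp affine_hyperplane\<close>)
  moreover have "affine hull F \<subseteq> hyp b c" using assms(3) by (simp add: hull_minimal affine_hyperplane hyp)
  ultimately have sub: "hyp a r \<subseteq> hyp b c" by simp
  \<comment> \<open>\<open>p\<close> is the foot of the perpendicular from the origin, and
    \<open>q - p\<close> is the component of \<open>b\<close> orthogonal to \<open>a\<close>. Since
    \<open>q\<close> and \<open>p\<close> agree on \<open>b\<close>, that component has norm
    0.\<close>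
  define p where "p = (r / (a \<bullet> a)) *\<^sub>R a"
  define q where "q = p + (b - ((b \<bullet> a) / (a \<bullet> a)) *\<^sub>R a)"
  have "p \<in> hyp a r" "q \<in> hyp a r" using assms(1) by (auto simp: p_def q_def hyp_def algebra_simps)
  then have "q \<bullet> b = p \<bullet> b" using sub by (auto simp: hyp_def)
  then show ?thesis
    using assms(1) by (simp add: q_def algebra_simps inner_commute power2_eq_square divide_simps)
qed

text \<open>The open set \<open>U\<close> gives \<open>closure T\<close> full dimension, so the
  facet has codimension 1 and no hyperplane of a non-proportional root can contain it.\<close>

lemma facet_generic_point:
  fixes T :: "'a::euclidean_space set"
  assumes rs: "root_system Phi" and a: "a \<in> Phi"
    and U: "open U" "U \<noteq> {}" "U \<subseteq> T"
    and facet: "(hyp a r \<inter> closure T) facet_of closure T"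
    and J: "finite J" "\<And>b c. (b, c) \<in> J \<Longrightarrow> b \<in> Phi \<and> b \<noteq> a \<and> b \<noteq> - a"
  obtains y where "y \<in> hyp a r \<inter> closure T" "\<And>b c. (b, c) \<in> J \<Longrightarrow> y \<notin> hyp b c"
proof -
  let ?F = "hyp a r \<inter> closure T"
  have "U \<subseteq> closure T" using U(3) closure_subset by blast
  then have "aff_dim (closure T) = DIM('a)"
    using aff_dim_subset[of U "closure T"] aff_dim_open[OF U(1,2)] aff_dim_le_DIM[of "closure T"] by simp
  then have F: "aff_dim ?F = int DIM('a) - 1" "convex ?F" "?F \<noteq> {}"
    using facet by (auto simp: facet_of_def face_of_imp_convex)
  have "a \<noteq> 0" using rs a by (auto simp: root_system_def)
  have "\<not> ?F \<subseteq> hyp b c" if "(b, c) \<in> J" for b c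
    using parallel_hyperplanes[OF \<open>a \<noteq> 0\<close> _ _ F(1,3), of r b c] root_parallel[OF rs _ a, of b] J(2)[OF that]
    by auto
  then show ?thesis using convex_avoid_hyperplanes[OF J(1) F(2,3)] that by fastforce
qed

text \<open>The flat side of the half ball is a relatively open piece of the hyperplane inside
  \<open>closure T\<close>, which gives codimension 1. It is a face because \<open>T\<close> lies on
  one side.\<close>

lemma facet_from_half_ball:
  fixes T :: "'a::euclidean_space set"
  assumes "convex T" "T \<subseteq> {x. x \<bullet> a < r}" "a \<noteq> 0" "w \<in> hyp a r" "d > 0"
    and U: "ball w d \<inter> {x. x \<bullet> a < r} \<subseteq> T"
  shows "(hyp a r \<inter> closure T) facet_of closure T"
proof -
  let ?L = "{x. a \<bullet> x < r}"
  have hyp: "hyp a r = {x. a \<bullet> x = r}" by (auto simp: hyp_def inner_commute)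
  have L: "{x. x \<bullet> a < r} = ?L" by (auto simp: inner_commute)
  have cl: "closure T \<subseteq> {x. a \<bullet> x \<le> r}"
    using assms(2) unfolding L by (intro closure_minimal) (auto simp: closed_halfspace_le)
  have "ball w d \<inter> closure ?L \<subseteq> closure (ball w d \<inter> ?L)" by (simp add: open_Int_closure_subset)
  also have "\<dots> \<subseteq> closure T" using U unfolding L by (rule closure_mono)
  finally have sub: "hyp a r \<inter> ball w d \<subseteq> hyp a r \<inter> closure T"
    using assms(3) by (auto simp: hyp closure_halfspace_lt)
  have "aff_dim (hyp a r) = int DIM('a) - 1" using assms(3) by (simp add: hyp)
  moreover have "aff_dim (hyp a r \<inter> ball w d) = aff_dim (hyp a r)"
    using assms(4,5) by (intro aff_dim_convex_Int_open) (auto simp: hyp convex_hyperplane)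
  ultimately have "aff_dim (hyp a r \<inter> closure T) = int DIM('a) - 1"
    using aff_dim_subset[OF sub] aff_dim_subset[of "hyp a r \<inter> closure T" "hyp a r"] by simp
  moreover have "aff_dim (closure T) = DIM('a)"
  proof -
    have "w \<in> closure (ball w d \<inter> ?L)"
      using assms(3-5) \<open>ball w d \<inter> closure ?L \<subseteq> closure (ball w d \<inter> ?L)\<close>
      by (auto simp: hyp closure_halfspace_lt)
    then have "ball w d \<inter> ?L \<noteq> {}" by auto
    then have "aff_dim (ball w d \<inter> ?L) = DIM('a)"
      by (intro aff_dim_open) (auto simp: open_halfspace_lt)
    moreover have "ball w d \<inter> ?L \<subseteq> closure T" using U closure_subset unfolding L by blast
    ultimately show ?thesis using aff_dim_subset aff_dim_le_DIM[of "closure T"] by (metis order_antisym)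
  qed
  moreover have "closure T \<inter> {x. a \<bullet> x = r} face_of closure T"
    using face_of_Int_supporting_hyperplane_le[of "closure T" a r] assms(1) cl by (auto simp: convex_closure)
  moreover have "w \<in> hyp a r \<inter> closure T" using sub assms(4,5) by auto
  ultimately show ?thesis unfolding facet_of_def by (auto simp: hyp Int_commute)
qed

text \<open>On a bounded set each \<open>b\<close> takes only finitely many integer values, so
  finitely many hyperplanes have to be avoided.\<close>

lemma convex_avoid_integers:
  fixes F :: "'a::euclidean_space set"
  assumes "finite Q" "convex F" "F \<noteq> {}" "bounded F" "\<And>b c. b \<in> Q \<Longrightarrow> \<not> F \<subseteq> hyp b c"
  shows "\<exists>p\<in>F. \<forall>b\<in>Q. p \<bullet> b \<notin> \<int>"
proof -
  obtain K where K: "\<And>x. x \<in> F \<Longrightarrow> norm x \<le> K" using assms(4) by (auto simp: bounded_iff)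
  define J where "J = (SIGMA b:Q. {c \<in> \<int>. \<bar>c\<bar> \<le> K * norm b})"
  have "finite J" unfolding J_def using assms(1) finite_abs_int_segment by (intro finite_SigmaI) auto
  then obtain p where p: "p \<in> F" "\<forall>(b, c)\<in>J. p \<notin> hyp b c"
    using convex_avoid_hyperplanes[of J F] assms(2,3,5) unfolding J_def by blast
  have "p \<bullet> b \<notin> \<int>" if b: "b \<in> Q" for b
  proof
    assume "p \<bullet> b \<in> \<int>"
    moreover have "\<bar>p \<bullet> b\<bar> \<le> K * norm b"
      using Cauchy_Schwarz_ineq2[of p b] K[OF p(1)] by (meson mult_right_mono norm_ge_zero order_trans)
    ultimately have "(b, p \<bullet> b) \<in> J" using b by (simp add: J_def)
    then show False using p(2) by (auto simp: hyp_def)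
  qed
  then show ?thesis using p(1) by blast
qed

text \<open>A connected set missing a hyperplane lies strictly on one side of it, hence so do the
  segments between its points. A component contains every connected subset of the complement that
  meets it.\<close>

lemma region_convex:
  assumes A: "\<And>H. H \<in> A \<Longrightarrow> \<exists>a r. H = hyp a r" and T: "T \<in> regions A"
  shows "convex T"
  unfolding convex_contains_segment
proof (intro ballI)
  fix x y assume xy: "x \<in> T" "y \<in> T"
  have con: "connected T" and sub: "T \<subseteq> UNIV - \<Union>A"
    using T in_components_connected in_components_subset unfolding regions_def by blast+
  have "closed_segment x y \<inter> H = {}" if "H \<in> A" for H
  proof -
    obtain a r where H: "H = hyp a r" using A \<open>H \<in> A\<close> by blast
    have "T \<inter> H = {}" using sub that by blast
    then have no: "a \<bullet> z \<noteq> r" if "z \<in> T" for z using that by (auto simp: H hyp_def inner_commute)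
    then have "(a \<bullet> x < r \<and> a \<bullet> y < r) \<or> (a \<bullet> x > r \<and> a \<bullet> y > r)"
      using connected_ivt_hyperplane[OF con xy, of a r] connected_ivt_hyperplane[OF con xy(2,1), of a r] xy
      by (meson linorder_less_linear not_less order_less_imp_le)
    then have "closed_segment x y \<subseteq> {z. a \<bullet> z < r} \<or> closed_segment x y \<subseteq> {z. a \<bullet> z > r}"
      using closed_segment_subset[OF _ _ convex_halfspace_lt, of x a r y]
        closed_segment_subset[OF _ _ convex_halfspace_gt, of x r a y] by auto
    then show ?thesis by (auto simp: H hyp_def inner_commute)
  qed
  then have "closed_segment x y \<subseteq> UNIV - \<Union>A" by blast
  then show "closed_segment x y \<subseteq> T"
    using components_maximal[of T "UNIV - \<Union>A" "closed_segment x y"] T xy unfolding regions_def by auto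
qed

lemma closure_inner_le:
  assumes "y \<in> closure T" "\<And>x. x \<in> T \<Longrightarrow> x \<bullet> b \<le> c"
  shows "y \<bullet> b \<le> c"
proof -
  have "closure T \<subseteq> {x. b \<bullet> x \<le> c}"
    using assms(2) by (intro closure_minimal closed_halfspace_le) (auto simp: inner_commute)
  then show ?thesis using assms(1) by (auto simp: inner_commute)
qed

lemma generic_ball:
  fixes w :: "'a::euclidean_space"
  assumes "finite Q" "\<forall>b\<in>Q. w \<bullet> b \<notin> \<int>" "open V" "w \<in> V"
  obtains d where "d > 0" "ball w d \<subseteq> V" "\<And>x b. x \<in> ball w d \<Longrightarrow> b \<in> Q \<Longrightarrow> x \<bullet> b \<notin> \<int>"
proof -
  have op: "open ((\<lambda>x. x \<bullet> b) -` (- \<int>))" for b :: 'a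
    by (intro open_vimage continuous_intros) (auto simp: open_closed[symmetric] closed_Ints)
  have "open (V \<inter> (\<Inter>b\<in>Q. (\<lambda>x. x \<bullet> b) -` (- \<int>)))"
    by (intro open_Int open_INT ballI assms(1,3) op)
  moreover have "w \<in> V \<inter> (\<Inter>b\<in>Q. (\<lambda>x. x \<bullet> b) -` (- \<int>))" using assms(2,4) by auto
  ultimately obtain d where "d > 0" "ball w d \<subseteq> V \<inter> (\<Inter>b\<in>Q. (\<lambda>x. x \<bullet> b) -` (- \<int>))"
    using open_contains_ball by meson
  then show ?thesis using that[of d] by blast
qed

section \<open>Dominant regions\<close>

locale dominant_region =
  fixes Phi S :: "'a::euclidean_space set" and k :: nat and R :: "'a set"
  assumes rs: "root_system Phi" and cr: "crystallographic Phi" and ss: "simple_system Phi S"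
    and reg: "R \<in> regions (catalan_arr Phi k)" and dom: "dominant (pos_roots Phi S) R"
begin

abbreviation P where "P \<equiv> pos_roots Phi S"
abbreviation I where "I \<equiv> theta P R"

lemma R_nonempty: "R \<noteq> {}"
  using reg in_components_nonempty unfolding regions_def by blast

lemma R_connected: "connected R"
  using reg in_components_connected unfolding regions_def by blast

lemma R_avoids: "a \<in> Phi \<Longrightarrow> r \<le> k \<Longrightarrow> x \<in> R \<Longrightarrow> x \<bullet> a \<noteq> real r"
proof
  assume a: "a \<in> Phi" "r \<le> k" "x \<in> R" "x \<bullet> a = real r"
  then have "x \<in> \<Union>(catalan_arr Phi k)" unfolding catalan_arr_def hyp_def by blast
  then show False using reg a(3) in_components_subset unfolding regions_def by blast
qed

lemma P_subset: "P \<subseteq> Phi" by (auto simp: pos_roots_def)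

lemma finite_P: "finite P"
  using finite_subset[OF P_subset] rs by (simp add: root_system_def)

lemma P_nonzero: "b \<in> P \<Longrightarrow> b \<noteq> 0"
  using P_subset rs unfolding root_system_def by (metis subsetD)

lemma P_pos: "b \<in> P \<Longrightarrow> x \<in> R \<Longrightarrow> x \<bullet> b > 0"
  using dom unfolding dominant_def by blast

text \<open>\<open>R\<close> is connected and misses the hyperplane of \<open>b\<close> at level
  \<open>i\<close>, so a single point decides for all of \<open>R\<close>. Memberships in the ideals
  can therefore be tested by inequalities at one fixed \<open>x\<close>.\<close>

lemma theta_iff:
  assumes "x \<in> R" "b \<in> P" "i \<le> k"
  shows "b \<in> I i \<longleftrightarrow> x \<bullet> b < real i"
proof
  assume lt: "x \<bullet> b < real i"
  have "y \<bullet> b < real i" if "y \<in> R" for y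
  proof (rule ccontr)
    assume "\<not> ?thesis"
    then have "\<exists>z\<in>R. b \<bullet> z = real i"
      using connected_ivt_hyperplane[OF R_connected assms(1) that, of b "real i"] lt
      by (auto simp: inner_commute)
    then obtain z where "z \<in> R" "b \<bullet> z = real i" by blast
    then show False using R_avoids[of b i z] P_subset assms by (auto simp: inner_commute)
  qed
  then show "b \<in> I i" using assms by (simp add: theta_def)
next
  assume "b \<in> I i"
  then show "x \<bullet> b < real i" using assms(1) unfolding theta_def by blast
qed

lemma not_theta_iff:
  assumes "x \<in> R" "b \<in> P" "i \<le> k"
  shows "b \<notin> I i \<longleftrightarrow> x \<bullet> b > real i"
proof -
  have "x \<bullet> b \<noteq> real i" using R_avoids[OF _ assms(3,1)] assms(2) P_subset by blast
  then show ?thesis using theta_iff[OF assms] by linarith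
qed

lemma theta_subset: "I i \<subseteq> P" by (auto simp: theta_def)

lemma theta_0: "I 0 = {}"
proof -
  obtain x where "x \<in> R" using R_nonempty by blast
  then have "b \<notin> I 0" for b using P_pos[of b x] unfolding theta_def by force
  then show ?thesis by blast
qed

text \<open>Dominance already empties \<open>theta\<close> at index 0, so the convention for the
  zeroth ideal holds by itself.\<close>

lemma chainI_theta: "chainI I = I"
  using theta_0 by (intro ext) (auto simp: chainI_def)

lemma P_diff:
  assumes "a \<in> P" "b \<in> P" "a \<noteq> b" "a \<bullet> b > 0"
  shows "a - b \<in> P \<or> b - a \<in> P"
proof -
  have "a - b \<in> Phi" using root_diff[OF rs cr] assms P_subset by blast
  moreover have "b - a \<in> Phi" using root_uminus[OF rs calculation] by simp
  moreover have "nn_int_comb S (a - b) \<or> nn_int_comb S (- (a - b))"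
    using calculation(1) ss unfolding simple_system_def by blast
  ultimately show ?thesis by (simp add: pos_roots_def)
qed

lemma P_double: "a \<in> P \<Longrightarrow> a + a \<notin> P"
proof
  assume "a \<in> P" "a + a \<in> P"
  then have "a \<in> Phi" "2 *\<^sub>R a \<in> Phi" using P_subset by (auto simp: scaleR_2)
  then have "(2::real) = 1 \<or> (2::real) = -1" using rs unfolding root_system_def by blast
  then show False by simp
qed

section \<open>Reduction of integer relations between affine forms\<close>

text \<open>
  A positive integer combination of the affine forms \<open>i - b\<close> (from \<open>B\<close>) and \<open>g - m\<close> (from \<open>G\<close>), all
  positive on \<open>R\<close>, which differs from \<open>N (r - \<alpha>)\<close> by a nonpositive constant.
\<close>

definition balanced :: "'a \<Rightarrow> nat \<Rightarrow> nat \<Rightarrow> ('a \<times> nat) multiset \<Rightarrow> ('a \<times> nat) multiset \<Rightarrow> bool" where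
  "balanced \<alpha> r N B G \<longleftrightarrow>
     (\<forall>(b, i) \<in># B. i \<le> k \<and> b \<in> I i \<and> (b, i) \<noteq> (\<alpha>, r)) \<and>
     (\<forall>(g, m) \<in># G. m \<le> k \<and> g \<in> P \<and> g \<notin> I m) \<and>
     real N *\<^sub>R \<alpha> + (\<Sum>p\<in>#G. fst p) = (\<Sum>p\<in>#B. fst p) \<and>
     (\<Sum>p\<in>#B. snd p) \<le> N * r + (\<Sum>p\<in>#G. snd p)"

lemma sum_mset_pos:
  assumes "x \<in> R" "\<forall>p \<in># M. fst p \<in> P"
  shows "x \<bullet> (\<Sum>p\<in>#M. fst p) \<ge> 0" "M \<noteq> {#} \<Longrightarrow> x \<bullet> (\<Sum>p\<in>#M. fst p) > 0"
proof -
  show 1: "x \<bullet> (\<Sum>p\<in>#M. fst p) \<ge> 0"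
    using assms(2)
    by (induction M) (use P_pos[OF _ assms(1)] in \<open>auto simp: inner_right_distrib less_imp_le add_nonneg_nonneg\<close>)
  show "x \<bullet> (\<Sum>p\<in>#M. fst p) > 0" if "M \<noteq> {#}"
    using assms(2) that
    by (induction M) (use P_pos[OF _ assms(1)] in \<open>force simp: inner_right_distrib intro: add_pos_pos\<close>)+
qed

text \<open>Strong induction on the number of terms. Each reduction yields a smaller balanced
  relation, trivial by induction; this is contradicted by the term just inserted or, when two terms
  cancel completely, by a strict inequality between the constants.\<close>

lemma balanced_trivial:
  assumes ind: "indecomposable P I k r \<alpha>" and al: "\<alpha> \<in> P" and r: "1 \<le> r" "r \<le> k"
  shows "balanced \<alpha> r N B G \<Longrightarrow> N = 0 \<and> B = {#} \<and> G = {#}"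
proof (induction "N + size B + size G" arbitrary: N B G rule: less_induct)
  case less
  obtain x where x: "x \<in> R" using R_nonempty by blast
  note th = theta_iff[OF x] and nth = not_theta_iff[OF x] and pos = P_pos[OF _ x]
  have bal: "\<And>b i. (b, i) \<in># B \<Longrightarrow> i \<le> k \<and> b \<in> I i \<and> (b, i) \<noteq> (\<alpha>, r)"
    "\<And>g m. (g, m) \<in># G \<Longrightarrow> m \<le> k \<and> g \<in> P \<and> g \<notin> I m"
    "real N *\<^sub>R \<alpha> + (\<Sum>p\<in>#G. fst p) = (\<Sum>p\<in>#B. fst p)"
    "(\<Sum>p\<in>#B. snd p) \<le> N * r + (\<Sum>p\<in>#G. snd p)"
    using less.prems unfolding balanced_def by auto
  have rk: "rk I k \<alpha> = enat r"
    and two: "\<And>i j b c. i + j = r \<Longrightarrow> b \<in> I i \<Longrightarrow> c \<in> I j \<Longrightarrow> \<alpha> \<noteq> b + c"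
    and three: "\<And>b t. b \<in> P \<Longrightarrow> \<alpha> + b \<in> P \<Longrightarrow> rk I k (\<alpha> + b) = enat t \<Longrightarrow> t \<le> k \<Longrightarrow> b \<in> I (t - r)"
    using ind unfolding indecomposable_def chainI_theta by blast+
  have ceil: "x \<bullet> b < i" "0 < i" "b \<in> P" if "b \<in> I i" "i \<le> k" for b i
  proof -
    show b: "b \<in> P" using that theta_subset by blast
    show "x \<bullet> b < i" using th[OF b] that by simp
    then show "0 < i" using pos[OF b] by linarith
  qed
  \<comment> \<open>The rank \<open>t\<close> of \<open>\<alpha> + c\<close> is at most
    \<open>i\<close>, so clause (iii) puts \<open>c\<close> in \<open>I (t - r)\<close>. As
    \<open>I 0\<close> is empty, \<open>r < t\<close>, and the truncated differences are
    genuine.\<close>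
  have up: "c \<in> I (i - r) \<and> r < i" if "\<alpha> + c \<in> I i" "i \<le> k" "c \<in> P" for c i
  proof -
    have "rk I k (\<alpha> + c) \<le> enat i" using rk_le[of "\<alpha> + c" I i k] ceil(2)[OF that(1,2)] that by auto
    then obtain t where t: "rk I k (\<alpha> + c) = enat t" "t \<le> i"
      by (metis enat_ile enat_ord_simps(1))
    then have "c \<in> I (t - r)" using three that ceil by auto
    then have "x \<bullet> c < real (t - r)" "t - r > 0" using ceil[of c "t - r"] t that by auto
    then show ?thesis using t th[OF that(3), of "i - r"] that by auto
  qed
  show ?case
  proof (cases "\<exists>b i g m. (b, i) \<in># B \<and> (g, m) \<in># G \<and> b \<bullet> g > 0")
    case True
    \<comment> \<open>Merge \<open>i - b\<close> and \<open>g - m\<close>; when \<open>g - b\<close> is a positive root and \<open>m < i\<close>, truncated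
      subtraction turns the level into 0, at the expense of the constant.\<close>
    then obtain b i g m where in_BG: "(b, i) \<in># B" "(g, m) \<in># G" and bg: "b \<bullet> g > 0" by blast
    obtain B0 where B: "B = add_mset (b, i) B0" using in_BG by (meson multi_member_split)
    obtain G0 where G: "G = add_mset (g, m) G0" using in_BG by (meson multi_member_split)
    have b: "i \<le> k" "b \<in> I i" "b \<in> P" "x \<bullet> b < i" and g: "m \<le> k" "g \<in> P" "g \<notin> I m" "x \<bullet> g > m"
      using bal(1)[OF in_BG(1)] bal(2)[OF in_BG(2)] ceil[of b i] nth[of g m] by auto
    have "b = g \<or> b - g \<in> P \<or> g - b \<in> P" using P_diff b g bg by blast
    then consider "b = g" | "b - g \<in> P" | "g - b \<in> P" by blast
    then show ?thesis
    proof cases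
      case 1
      then have "m < i" using b g by simp
      then have "balanced \<alpha> r N B0 G0" "(\<Sum>p\<in>#B0. snd p) < N * r + (\<Sum>p\<in>#G0. snd p)"
        using less.prems 1 unfolding balanced_def B G by auto
      then have False using less.hyps[of N B0 G0] B G by auto
      then show ?thesis ..
    next
      case 2
      then have "x \<bullet> b > x \<bullet> g" using pos[of "b - g"] by (simp add: inner_diff_right)
      then have "m < i" using b g by simp
      then have d: "b - g \<in> I (i - m)" using th[OF 2, of "i - m"] b g by (simp add: inner_diff_right)
      \<comment> \<open>The merged form must not be \<open>r - \<alpha>\<close> itself: otherwise
        \<open>\<alpha> + g = b\<close> lies in \<open>I i\<close>, and clause (iii) would put
        \<open>g\<close> in \<open>I m\<close>.\<close>
      have "(b - g, i - m) \<noteq> (\<alpha>, r)"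
      proof
        assume "(b - g, i - m) = (\<alpha>, r)"
        then have "\<alpha> + g \<in> I i" "i - r = m" using b \<open>m < i\<close> by auto
        then show False using up[of g i] b g by auto
      qed
      then have "balanced \<alpha> r N (add_mset (b - g, i - m) B0) G0"
        using less.prems d b \<open>m < i\<close> unfolding balanced_def B G by (auto simp: algebra_simps)
      then have False using less.hyps[of N "add_mset (b - g, i - m) B0" G0] B G by auto
      then show ?thesis ..
    next
      case 3
      have "g - b \<notin> I (m - i)"
        using nth[OF 3, of "m - i"] pos[OF 3] b g by (cases "i \<le> m") (auto simp: inner_diff_right)
      then have "balanced \<alpha> r N B0 (add_mset (g - b, m - i) G0)"
        using less.prems 3 unfolding balanced_def B G by (auto simp: algebra_simps)
      then have False using less.hyps[of N B0 "add_mset (g - b, m - i) G0"] B G by auto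
      then show ?thesis ..
    qed
  next
    case no_BG: False
    show ?thesis
    proof (cases "N > 0 \<and> (\<exists>b i. (b, i) \<in># B \<and> \<alpha> \<bullet> b > 0)")
      case True
      \<comment> \<open>Cancel one copy of \<open>r - \<alpha>\<close> against \<open>i - b\<close>.\<close>
      then obtain b i N0 where in_B: "(b, i) \<in># B" and ab: "\<alpha> \<bullet> b > 0" and N: "N = Suc N0"
        using gr0_implies_Suc by blast
      obtain B0 where B: "B = add_mset (b, i) B0" using in_B by (meson multi_member_split)
      have b: "i \<le> k" "b \<in> I i" "b \<in> P" "x \<bullet> b < i" "(b, i) \<noteq> (\<alpha>, r)" "0 < i"
        using bal(1)[OF in_B] ceil[of b i] by auto
      have "\<alpha> = b \<or> \<alpha> - b \<in> P \<or> b - \<alpha> \<in> P" using P_diff b al ab by blast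
      then consider "\<alpha> = b" | "\<alpha> - b \<in> P" | "b - \<alpha> \<in> P" by blast
      then show ?thesis
      proof cases
        case 1
        \<comment> \<open>Minimality of the rank gives \<open>r \<le> i\<close>; the exclusion of
          the pair \<open>(\<alpha>, r)\<close> makes it strict.\<close>
        have "enat r \<le> enat i" using rk_le[of \<alpha> I i k] rk b 1 by auto
        then have "r < i" using 1 b by auto
        then have "balanced \<alpha> r N0 B0 G" "(\<Sum>p\<in>#B0. snd p) < N0 * r + (\<Sum>p\<in>#G. snd p)"
          using less.prems 1 unfolding balanced_def B N by (auto simp: algebra_simps)
        then have False using less.hyps[of N0 B0 G] B N by auto
        then show ?thesis ..
      next
        case 2
        \<comment> \<open>Otherwise \<open>\<alpha>\<close> is a sum of elements of
          \<open>I i\<close> and \<open>I (r - i)\<close>, against clause (ii); emptiness of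
          \<open>I 0\<close> rules out truncation.\<close>
        have "\<alpha> - b \<notin> I (r - i)"
        proof
          assume d: "\<alpha> - b \<in> I (r - i)"
          then have "i < r" using theta_0 by (cases "r - i") auto
          then show False using two[of i "r - i" b "\<alpha> - b"] b d by auto
        qed
        then have "balanced \<alpha> r N0 B0 (add_mset (\<alpha> - b, r - i) G)"
          using less.prems 2 r unfolding balanced_def B N by (auto simp: algebra_simps)
        then have False using less.hyps[of N0 B0 "add_mset (\<alpha> - b, r - i) G"] B N by auto
        then show ?thesis ..
      next
        case 3
        have d: "b - \<alpha> \<in> I (i - r)" "r < i" using up[of "b - \<alpha>" i] 3 b by auto
        \<comment> \<open>No root is twice another root, so the new pair again differs from
          \<open>(\<alpha>, r)\<close>.\<close>
        have "b - \<alpha> \<noteq> \<alpha>" using P_double[OF al] b by (metis diff_add_cancel)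
        then have "balanced \<alpha> r N0 (add_mset (b - \<alpha>, i - r) B0) G"
          using less.prems d b unfolding balanced_def B N by (auto simp: algebra_simps)
        then have False using less.hyps[of N0 "add_mset (b - \<alpha>, i - r) B0" G] B N by auto
        then show ?thesis ..
      qed
    next
      case no_B: False
      \<comment> \<open>No reduction applies, so the common value of the two sides has nonpositive square norm.\<close>
      let ?b = "\<Sum>p\<in>#B. fst p" and ?g = "\<Sum>p\<in>#G. fst p"
      have BP: "\<forall>p \<in># B. fst p \<in> P" and GP: "\<forall>p \<in># G. fst p \<in> P"
        using bal(1,2) theta_subset by fastforce+
      have "real N * (\<alpha> \<bullet> ?b) \<le> 0"
        using no_B by (cases "N = 0") (auto simp: inner_sum_mset not_less intro!: mult_nonneg_nonpos sum_mset_nonpos)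
      moreover have "?g \<bullet> ?b \<le> 0"
      proof -
        have "?g \<bullet> fst p \<le> 0" if "p \<in># B" for p
        proof -
          have "fst p \<bullet> fst q \<le> 0" if "q \<in># G" for q
            using no_BG that \<open>p \<in># B\<close> by (metis not_less prod.collapse)
          then have "fst p \<bullet> ?g \<le> 0" unfolding inner_sum_mset by (rule sum_mset_nonpos)
          then show ?thesis by (simp add: inner_commute)
        qed
        then show ?thesis unfolding inner_sum_mset by (rule sum_mset_nonpos)
      qed
      moreover have "?b \<bullet> ?b = real N * (\<alpha> \<bullet> ?b) + ?g \<bullet> ?b"
        by (subst (1) bal(3)[symmetric]) (simp add: inner_left_distrib)
      ultimately have "?b \<bullet> ?b \<le> 0" by linarith
      then have "?b \<bullet> ?b = 0" using inner_ge_zero[of ?b] by linarith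
      then have "?b = 0" by simp
      \<comment> \<open>Every positive root is positive at \<open>x\<close>, so a vanishing sum of
        positive roots has no terms.\<close>
      then have "B = {#}" using sum_mset_pos(2)[OF x BP] by (metis inner_zero_right less_irrefl)
      have "real N * (x \<bullet> \<alpha>) + x \<bullet> ?g = 0"
        using arg_cong[OF bal(3), of "\<lambda>v. x \<bullet> v"] \<open>?b = 0\<close> by (simp add: inner_right_distrib)
      moreover have "real N * (x \<bullet> \<alpha>) \<ge> 0" using pos[OF al] by simp
      ultimately have "real N * (x \<bullet> \<alpha>) = 0" "x \<bullet> ?g = 0"
        using sum_mset_pos(1)[OF x GP] by linarith+
      then have "N = 0" "G = {#}" using pos[OF al] sum_mset_pos(2)[OF x GP] by auto
      then show ?thesis using \<open>B = {#}\<close> by simp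
    qed
  qed
qed

section \<open>From ceilings to indecomposable elements\<close>

text \<open>The inequalities of \<open>R\<close> hold weakly at \<open>y\<close>, and no positive
  root other than \<open>\<alpha>\<close> attains an integer level up to \<open>k\<close> there. A
  decomposition of smaller rank would break them, a forbidden two-term sum would make another root
  tight, and the slack at \<open>\<alpha> + b\<close> passes to \<open>b\<close>.\<close>

lemma indecomposableI:
  assumes al: "\<alpha> \<in> P" and r: "1 \<le> r" "r \<le> k" and I: "\<alpha> \<in> I r"
    and y: "y \<in> closure R" "y \<bullet> \<alpha> = real r"
    and gen: "\<And>b i. b \<in> P \<Longrightarrow> b \<noteq> \<alpha> \<Longrightarrow> i \<le> k \<Longrightarrow> y \<bullet> b \<noteq> real i"
  shows "indecomposable P I k r \<alpha>"
proof -
  have le: "y \<bullet> b \<le> real i" if "b \<in> I i" for b i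
    using closure_inner_le[OF y(1), of b] that unfolding theta_def by (simp add: less_imp_le)
  have ge: "y \<bullet> b \<ge> 0" if "b \<in> P" for b
    using closure_inner_le[OF y(1), of "- b" 0] P_pos[OF that] by (simp add: less_imp_le)
  have dec: "y \<bullet> sum_list (map fst ds) \<le> real (sum_list (map snd ds))"
    if "\<forall>(b, r)\<in>set ds. r \<in> {1..k} \<and> b \<in> I r" for ds
    using that
  proof (induction ds)
    case (Cons d ds)
    obtain b i where d: "d = (b, i)" by force
    have "y \<bullet> b \<le> real i" using le Cons.prems unfolding d by auto
    then show ?case using Cons unfolding d by (simp add: inner_right_distrib)
  qed simp
  have "rk I k \<alpha> = enat r"
  proof (rule antisym)
    show "rk I k \<alpha> \<le> enat r" using rk_le[of \<alpha> I r k] I r by simp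
    show "enat r \<le> rk I k \<alpha>"
      unfolding rk_def
    proof (rule Inf_greatest)
      fix n assume "n \<in> {enat (sum_list (map snd ds)) | ds.
       ds \<noteq> [] \<and> (\<forall>(b, r)\<in>set ds. r \<in> {1..k} \<and> b \<in> I r) \<and> sum_list (map fst ds) = \<alpha>}"
      then obtain ds where ds: "n = enat (sum_list (map snd ds))"
        "\<forall>(b, r)\<in>set ds. r \<in> {1..k} \<and> b \<in> I r" "sum_list (map fst ds) = \<alpha>" by blast
      then have "real r \<le> real (sum_list (map snd ds))" using dec[OF ds(2)] y(2) by simp
      then show "enat r \<le> n" using ds(1) by simp
    qed
  qed
  moreover have "\<alpha> \<noteq> b + c" if "i + j = r" "b \<in> I i" "c \<in> I j" for i j b c
  proof
    assume eq: "\<alpha> = b + c"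
    then have "y \<bullet> b + y \<bullet> c = real i + real j" using y(2) that(1) by (auto simp: inner_right_distrib)
    then have "y \<bullet> b = real i" using le[OF that(2)] le[OF that(3)] by linarith
    moreover have "b \<noteq> \<alpha>" using eq P_nonzero that(3) theta_subset by auto
    ultimately show False using gen[of b i] that r theta_subset by auto
  qed
  moreover have "b \<in> I (t - r)"
    if b: "b \<in> P" "\<alpha> + b \<in> P" and t: "rk I k (\<alpha> + b) = enat t" "t \<le> k" for b t
  proof -
    obtain ds where ds: "\<forall>(b, r)\<in>set ds. r \<in> {1..k} \<and> b \<in> I r"
      "sum_list (map fst ds) = \<alpha> + b" "sum_list (map snd ds) = t" 
      by (rule rk_attained[OF t(1)]) (rule that)
    then have "y \<bullet> (\<alpha> + b) \<le> real t" using dec[OF ds(1)] by simp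
    moreover have "y \<bullet> (\<alpha> + b) \<noteq> real t" using gen[OF b(2) _ t(2)] P_nonzero[OF b(1)] by simp
    ultimately have lt: "y \<bullet> b < real t - real r" using y(2) by (simp add: inner_right_distrib)
    \<comment> \<open>Since \<open>y \<bullet> b\<close> is nonnegative, the strict bound forces
      \<open>r < t\<close>, so the truncated difference agrees with the real one.\<close>
    then have tr: "real (t - r) = real t - real r" using ge[OF b(1)] by (simp add: of_nat_diff)
    show ?thesis
    proof (rule ccontr)
      assume n: "b \<notin> I (t - r)"
      have diff_le_k: "t - r \<le> k" using t(2) by simp
      have "x \<bullet> (- b) \<le> - real (t - r)" if "x \<in> R" for x
        using not_theta_iff[OF that b(1) diff_le_k] n by simp
      then have "y \<bullet> (- b) \<le> - real (t - r)" using closure_inner_le[OF y(1)] by blast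
      then show False using lt tr by simp
    qed
  qed
  ultimately show ?thesis unfolding indecomposable_def chainI_theta using I by blast
qed

text \<open>Formulated for a subset \<open>T\<close> of \<open>R\<close> with interior points so
  that it covers both \<open>R\<close> itself and the alcove \<open>B\<close>.\<close>

lemma ceiling_imp_indecomposable:
  assumes al: "\<alpha> \<in> P" and r: "1 \<le> r" "r \<le> k"
    and T: "T \<subseteq> R" and U: "open U" "U \<noteq> {}" "U \<subseteq> T"
    and ceil: "ceiling A T (hyp \<alpha> (real r))"
  shows "indecomposable P I k r \<alpha>"
proof -
  obtain x where x: "x \<in> T" "x \<in> R" using T U by blast
  have "x \<bullet> \<alpha> < real r"
  proof (rule ccontr)
    assume "\<not> ?thesis"
    \<comment> \<open>Scaling \<open>x\<close> down to level \<open>r\<close> gives a point where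
      the segment from the origin crosses the hyperplane.\<close>
    then have "real r \<le> x \<bullet> \<alpha>" "0 < x \<bullet> \<alpha>" using P_pos[OF al x(2)] by auto
    then have "(real r / (x \<bullet> \<alpha>)) *\<^sub>R x \<in> closed_segment 0 x \<inter> hyp \<alpha> (real r)"
      by (auto simp: closed_segment_def hyp_def intro!: exI[of _ "real r / (x \<bullet> \<alpha>)"])
    then show False using ceil x(1) unfolding ceiling_def by blast
  qed
  then have I: "\<alpha> \<in> I r" using theta_iff[OF x(2) al r(2)] by simp
  define J where "J = (P - {\<alpha>}) \<times> real ` {..k}"
  have "finite J" using finite_P by (simp add: J_def)
  moreover have "b \<in> Phi \<and> b \<noteq> \<alpha> \<and> b \<noteq> - \<alpha>" if "(b, c) \<in> J" for b c
    using that P_subset P_pos[OF _ x(2), of b] P_pos[OF al x(2)] by (auto simp: J_def)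
  ultimately obtain y where y: "y \<in> hyp \<alpha> (real r) \<inter> closure T" "\<And>b c. (b, c) \<in> J \<Longrightarrow> y \<notin> hyp b c"
    using facet_generic_point[OF rs _ U, of \<alpha> "real r" J] ceil al P_subset
    unfolding ceiling_def wall_def by blast
  show ?thesis
  proof (rule indecomposableI[OF al r I])
    show "y \<in> closure R" using y(1) closure_mono[OF T] by blast
    show "y \<bullet> \<alpha> = real r" using y(1) by (simp add: hyp_def)
    show "y \<bullet> b \<noteq> real i" if "b \<in> P" "b \<noteq> \<alpha>" "i \<le> k" for b i
      using y(2)[of b "real i"] that by (auto simp: J_def hyp_def)
  qed
qed

section \<open>Regions and alcoves described by inequalities\<close>

text \<open>Points with equal sign vectors are joined by a segment that crosses no hyperplane. A
  negative root is negative along the segment, while the levels of the arrangement are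
  nonnegative.\<close>

lemma mem_R:
  assumes x: "x \<in> R" and z: "\<And>b i. b \<in> P \<Longrightarrow> i \<le> k \<Longrightarrow> if b \<in> I i then z \<bullet> b < real i else z \<bullet> b > real i"
  shows "z \<in> R"
proof -
  have "closed_segment x z \<inter> hyp a (real i) = {}" if a: "a \<in> Phi" "i \<le> k" for a i
  proof -
    consider "a \<in> P" | "- a \<in> P"
      using a(1) ss root_uminus[OF rs a(1)] unfolding simple_system_def pos_roots_def by blast
    then show ?thesis
    proof cases
      case 1
      have "closed_segment x z \<subseteq> {w. a \<bullet> w < real i} \<or> closed_segment x z \<subseteq> {w. a \<bullet> w > real i}"
        using z[OF 1 a(2)] theta_iff[OF x 1 a(2)] not_theta_iff[OF x 1 a(2)]
          closed_segment_subset[OF _ _ convex_halfspace_lt, of x a "real i" z]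
          closed_segment_subset[OF _ _ convex_halfspace_gt, of x "real i" a z]
        by (auto simp: inner_commute split: if_splits)
      then show ?thesis by (auto simp: hyp_def inner_commute)
    next
      case 2
      have "z \<bullet> (- a) > 0" using z[OF 2, of 0] theta_0 by simp
      then have "closed_segment x z \<subseteq> {w. a \<bullet> w < 0}"
        using P_pos[OF 2 x] closed_segment_subset[OF _ _ convex_halfspace_lt, of x a 0 z]
        by (auto simp: inner_commute)
      then show ?thesis by (force simp: hyp_def inner_commute)
    qed
  qed
  then have "closed_segment x z \<subseteq> UNIV - \<Union>(catalan_arr Phi k)" unfolding catalan_arr_def by blast
  then have "closed_segment x z \<subseteq> R"
    using components_maximal[of R "UNIV - \<Union>(catalan_arr Phi k)" "closed_segment x z"] reg x
    unfolding regions_def by auto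
  then show ?thesis by auto
qed

lemma R_open: "open R"
proof -
  have "catalan_arr Phi k = (\<lambda>(a, i). hyp a (real i)) ` (Phi \<times> {..k})"
    by (auto simp: catalan_arr_def)
  moreover have "finite Phi" using rs by (simp add: root_system_def)
  ultimately have "finite (catalan_arr Phi k)" by simp
  moreover have "closed H" if H: "H \<in> catalan_arr Phi k" for H
  proof -
    obtain a i where "H = hyp a (real i)" using H unfolding catalan_arr_def by blast
    then have "H = {x. a \<bullet> x = real i}" by (simp add: hyp_def inner_commute)
    then show ?thesis by (simp add: closed_hyperplane)
  qed
  ultimately have "closed (\<Union>(catalan_arr Phi k))" by (intro closed_Union) auto
  then show ?thesis using reg open_components[of "UNIV - \<Union>(catalan_arr Phi k)" R]
    unfolding regions_def by (simp add: open_Diff)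
qed

lemma R_convex: "convex R"
  by (rule region_convex[OF _ reg]) (auto simp: catalan_arr_def)

text \<open>\<open>U\<close> is connected and off the affine arrangement, so it lies in one alcove.
  The Catalan arrangement is part of the affine one, so this alcove cannot leave
  \<open>R\<close>.\<close>

lemma alcove_exists:
  assumes U: "convex U" "U \<noteq> {}" "U \<subseteq> R" "\<And>x a. x \<in> U \<Longrightarrow> a \<in> Phi \<Longrightarrow> x \<bullet> a \<notin> \<int>"
  obtains B where "B \<in> regions (affine_arr Phi)" "U \<subseteq> B" "B \<subseteq> R"
proof -
  let ?C = "UNIV - \<Union>(affine_arr Phi)"
  have "x \<notin> hyp a (real_of_int r)" if "x \<in> U" "a \<in> Phi" for x a r
    using U(4)[OF that] by (auto simp: hyp_def)
  then have UC: "U \<subseteq> ?C" unfolding affine_arr_def by blast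
  obtain u where u: "u \<in> U" using U(2) by blast
  define B where "B = connected_component_set ?C u"
  have reg_B: "B \<in> components ?C" using UC u unfolding B_def by (auto simp: components_def)
  have "U \<subseteq> B" using components_maximal[OF reg_B convex_connected[OF U(1)] UC] u UC
    unfolding B_def by (meson connected_component_maximal U(1) convex_connected)
  moreover have "B \<subseteq> R"
  proof (rule components_maximal)
    show "R \<in> components (UNIV - \<Union>(catalan_arr Phi k))" using reg unfolding regions_def .
    show "connected B" using in_components_connected[OF reg_B] .
    have "catalan_arr Phi k \<subseteq> affine_arr Phi"
      unfolding catalan_arr_def affine_arr_def by (force intro: exI[of _ "int _"])
    then show "B \<subseteq> UNIV - \<Union>(catalan_arr Phi k)" using in_components_subset[OF reg_B] by blast
    show "R \<inter> B \<noteq> {}" using u U(3) \<open>U \<subseteq> B\<close> by blast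
  qed
  ultimately show ?thesis using that reg_B unfolding regions_def by blast
qed

section \<open>From indecomposable elements to ceilings\<close>

text \<open>Rounds the real coefficients of a Farkas relation to integers, producing a balanced
  relation with \<open>q > 0\<close> copies of \<open>r - \<alpha>\<close>, which
  \<open>balanced_trivial\<close> excludes. \<open>c0\<close> is the coefficient of the constant
  form.\<close>

lemma no_positive_relation:
  assumes ind: "indecomposable P I k r \<alpha>" and al: "\<alpha> \<in> P" and r: "1 \<le> r" "r \<le> k"
    and C: "finite C" "\<And>b i. (b, i) \<in> C \<Longrightarrow> i \<le> k \<and> b \<in> I i \<and> (b, i) \<noteq> (\<alpha>, r)"
    and F: "finite F" "\<And>g m. (g, m) \<in> F \<Longrightarrow> m \<le> k \<and> g \<in> P \<and> g \<notin> I m"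
    and c: "\<And>j. c j \<ge> 0" "c0 \<ge> 0"
    and vec: "\<alpha> + (\<Sum>j\<in>F. c j *\<^sub>R fst j) = (\<Sum>j\<in>C. c j *\<^sub>R fst j)"
    and const: "real r + (\<Sum>j\<in>F. c j * real (snd j)) = c0 + (\<Sum>j\<in>C. c j * real (snd j))"
  shows False
proof -
  \<comment> \<open>The Cartan pairing with the coroot of \<open>b\<close>: linear in its second
    argument \<open>a\<close>, integral on roots.\<close>
  define w where "w b a = 2 * (a \<bullet> b) / (b \<bullet> b)" for a b :: 'a
  have w_int: "w b a \<in> \<int>" if "b \<in> Phi" "a \<in> Phi" for a b
    using cr that unfolding crystallographic_def w_def by blast
  have w_lin: "w b (x + y) = w b x + w b y" "w b (s *\<^sub>R x) = s * w b x" "w b (x - y) = w b x - w b y"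
    for b x y s by (simp_all add: w_def inner_left_distrib inner_diff_left add_divide_distrib diff_divide_distrib distrib_left right_diff_distrib)
  have w_sum: "w b (\<Sum>j\<in>A. f j) = (\<Sum>j\<in>A. w b (f j))" for b A and f :: "'a \<times> nat \<Rightarrow> 'a"
    by (simp add: w_def inner_sum_left sum_distrib_left sum_divide_distrib)
  \<comment> \<open>\<open>g j\<close> dominates the level of \<open>j\<close> and all its pairings.
    With precision \<open>1 / M\<close> every accumulated error is at most
    \<open>(M - 1) / M\<close>, hence below 1.\<close>
  define g where "g j = real k + (\<Sum>b\<in>Phi. \<bar>w b (fst j)\<bar>)" for j :: "'a \<times> nat"
  have g_nonneg: "g j \<ge> 0" for j unfolding g_def by (simp add: sum_nonneg)
  define M where "M = 1 + (\<Sum>j\<in>C. g j) + (\<Sum>j\<in>F. g j)"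
  have M: "M \<ge> 1" unfolding M_def by (simp add: sum_nonneg g_nonneg)
  obtain q p where q: "q > 0" and p: "\<And>j. j \<in> C \<union> F \<Longrightarrow> \<bar>real q * c j - of_int (p j)\<bar> < 1 / M"
    using simultaneous_approx[of "C \<union> F" "1 / M" c] C(1) F(1) M by auto
  define d where "d j = real q * c j - of_int (p j)" for j
  have small: "\<bar>(\<Sum>j\<in>C. d j * f j) - (\<Sum>j\<in>F. d j * f j)\<bar> < 1" if f: "\<And>j. j \<in> C \<union> F \<Longrightarrow> \<bar>f j\<bar> \<le> g j" for f
  proof -
    have le: "\<bar>\<Sum>j\<in>A. d j * f j\<bar> \<le> (1 / M) * (\<Sum>j\<in>A. g j)" if "A \<subseteq> C \<union> F" for A
    proof -
      have "\<bar>\<Sum>j\<in>A. d j * f j\<bar> \<le> (\<Sum>j\<in>A. \<bar>d j * f j\<bar>)" by (rule sum_abs)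
      also have "\<dots> \<le> (\<Sum>j\<in>A. (1 / M) * g j)"
      proof (rule sum_mono)
        fix j assume "j \<in> A"
        then have j: "j \<in> C \<union> F" using that by blast
        have "\<bar>d j\<bar> \<le> 1 / M" "\<bar>f j\<bar> \<le> g j" using p[OF j] f[OF j] unfolding d_def by linarith+
        then show "\<bar>d j * f j\<bar> \<le> (1 / M) * g j" unfolding abs_mult using M by (intro mult_mono) auto
      qed
      finally show ?thesis by (simp add: sum_distrib_left)
    qed
    have "\<bar>(\<Sum>j\<in>C. d j * f j) - (\<Sum>j\<in>F. d j * f j)\<bar> \<le> (1 / M) * (\<Sum>j\<in>C. g j) + (1 / M) * (\<Sum>j\<in>F. g j)"
      using le[of C] le[of F] by (simp del: times_divide_eq_left)
    also have "\<dots> = (M - 1) / M" by (simp add: M_def add_divide_distrib)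
    also have "\<dots> < 1" using M by simp
    finally show ?thesis .
  qed
  have root: "j \<in> C \<union> F \<Longrightarrow> fst j \<in> Phi" for j
    using C(2)[of "fst j" "snd j"] F(2)[of "fst j" "snd j"] theta_subset P_subset by auto
  \<comment> \<open>\<open>v\<close> is the defect of the rounded relation; since the exact relation
    holds, only the rounding errors \<open>d\<close> contribute to it.\<close>
  define v where "v = real q *\<^sub>R \<alpha> + (\<Sum>j\<in>F. of_int (p j) *\<^sub>R fst j) - (\<Sum>j\<in>C. of_int (p j) *\<^sub>R fst j)"
  have v: "v = (\<Sum>j\<in>C. d j *\<^sub>R fst j) - (\<Sum>j\<in>F. d j *\<^sub>R fst j)"
  proof -
    have "real q *\<^sub>R \<alpha> = real q *\<^sub>R ((\<Sum>j\<in>C. c j *\<^sub>R fst j) - (\<Sum>j\<in>F. c j *\<^sub>R fst j))"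
      using vec by (simp add: eq_diff_eq)
    then show ?thesis
      by (simp add: v_def d_def scaleR_diff_left sum_subtractf scaleR_diff_right scaleR_sum_right)
  qed
  \<comment> \<open>The crystallographic pairings of \<open>v\<close> are integers of absolute value less than 1.\<close>
  have "v \<bullet> b = 0" if b: "b \<in> Phi" for b
  proof -
    have "w b v \<in> \<int>" unfolding v_def w_lin w_sum
      using w_int[OF b] al P_subset root by (intro Ints_diff Ints_add Ints_sum Ints_mult) auto
    moreover have "\<bar>w b v\<bar> < 1"
    proof -
      have "\<bar>w b (fst j)\<bar> \<le> g j" for j
        unfolding g_def using member_le_sum[OF b, of "\<lambda>b. \<bar>w b (fst j)\<bar>"] rs by (simp add: root_system_def)
      then show ?thesis unfolding v w_lin w_sum by (intro small) auto
    qed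
    ultimately have "w b v = 0" using Ints_nonzero_abs_less1 by blast
    moreover have "b \<noteq> 0" using b rs by (auto simp: root_system_def)
    ultimately show ?thesis by (simp add: w_def)
  qed
  then have "orthogonal v v"
    using orthogonal_to_span[of v Phi v] rs unfolding root_system_def orthogonal_def by auto
  then have v0: "v = 0" by (simp add: orthogonal_def)
  have p_nonneg: "p j \<ge> 0" if "j \<in> C \<union> F" for j
  proof -
    have "1 / M \<le> 1" "real q * c j \<ge> 0" using M c(1) by auto
    then have "real_of_int (p j) > -1" using p[OF that] by linarith
    then show ?thesis by linarith
  qed
  define n where "n j = nat (p j)" for j
  have n: "real (n j) = of_int (p j)" if "j \<in> C \<union> F" for j using p_nonneg[OF that] by (simp add: n_def)
  define B where "B = (\<Sum>j\<in>C. replicate_mset (n j) j)"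
  define G where "G = (\<Sum>j\<in>F. replicate_mset (n j) j)"
  have "real q *\<^sub>R \<alpha> + (\<Sum>p\<in>#G. fst p) = (\<Sum>p\<in>#B. fst p)"
    using v0 unfolding v_def B_def G_def sum_mset_sum_replicate[OF C(1)] sum_mset_sum_replicate[OF F(1)]
    by (simp add: n)
  \<comment> \<open>Rounding shifts the comparison of the constants by less than 1, which
    integrality absorbs; \<open>c0 \<ge> 0\<close> turns the equation into an inequality.\<close>
  moreover have "(\<Sum>p\<in>#B. snd p) \<le> q * r + (\<Sum>p\<in>#G. snd p)"
  proof -
    have "\<bar>(\<Sum>j\<in>C. d j * real (snd j)) - (\<Sum>j\<in>F. d j * real (snd j))\<bar> < 1"
    proof (rule small)
      fix j assume "j \<in> C \<union> F"
      then have "snd j \<le> k" using C(2)[of "fst j" "snd j"] F(2)[of "fst j" "snd j"] by auto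
      then show "\<bar>real (snd j)\<bar> \<le> g j" unfolding g_def by (simp add: sum_nonneg add_increasing2)
    qed
    moreover have "real q * real r = real q * c0 + real q * (\<Sum>j\<in>C. c j * real (snd j)) - real q * (\<Sum>j\<in>F. c j * real (snd j))"
      using arg_cong[OF const, of "\<lambda>x. real q * x"] by (simp add: distrib_left)
    moreover have "real q * c0 \<ge> 0" using c(2) by simp
    moreover have dsum: "(\<Sum>j\<in>A. d j * real (snd j)) = real q * (\<Sum>j\<in>A. c j * real (snd j)) - (\<Sum>j\<in>A. of_int (p j) * real (snd j))" for A
      by (simp add: d_def left_diff_distrib sum_subtractf sum_distrib_left mult.assoc)
    ultimately have "(\<Sum>j\<in>C. of_int (p j) * real (snd j)) < real q * real r + (\<Sum>j\<in>F. of_int (p j) * real (snd j)) + 1"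
      using dsum[of C] dsum[of F] by linarith
    then have "(\<Sum>j\<in>C. real (n j) * real (snd j)) < real q * real r + (\<Sum>j\<in>F. real (n j) * real (snd j)) + 1"
      by (simp add: n)
    then have "real (\<Sum>p\<in>#B. snd p) < real (q * r + (\<Sum>p\<in>#G. snd p) + 1)"
      unfolding B_def G_def sum_mset_sum_replicate_nat[OF C(1)] sum_mset_sum_replicate_nat[OF F(1)] by simp
    then show ?thesis unfolding of_nat_less_iff by simp
  qed
  ultimately have "balanced \<alpha> r q B G"
    unfolding balanced_def B_def G_def using in_sum_replicate[OF C(1)] in_sum_replicate[OF F(1)] C(2) F(2)
    by blast
  then show False using balanced_trivial[OF ind al r] q by blast
qed

text \<open>Farkas' lemma by separation: \<open>r - \<alpha>\<close> lies outside the finitely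
  generated, hence closed, cone of the other forms. Moving from a point of \<open>R\<close> along
  the separating vector reaches \<open>\<alpha> = r\<close> while the other forms stay
  positive.\<close>

lemma wall_point:
  assumes ind: "indecomposable P I k r \<alpha>" and al: "\<alpha> \<in> P" and r: "1 \<le> r" "r \<le> k"
  obtains y where "y \<bullet> \<alpha> = real r"
    "\<And>b i. b \<in> P \<Longrightarrow> i \<le> k \<Longrightarrow> (b, i) \<noteq> (\<alpha>, r) \<Longrightarrow> if b \<in> I i then y \<bullet> b < real i else y \<bullet> b > real i"
proof -
  define J where "J = P \<times> {..k} - {(\<alpha>, r)}"
  define C where "C = {j \<in> J. fst j \<in> I (snd j)}"
  define F where "F = {j \<in> J. fst j \<notin> I (snd j)}"
  \<comment> \<open>The dummy index \<open>(0, 1)\<close> stands for the constant form 1.\<close>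
  define f where "f j = (if fst j \<in> I (snd j) \<or> fst j = 0 then (- fst j, real (snd j)) else (fst j, - real (snd j)))"
    for j :: "'a \<times> nat"
  \<comment> \<open>A pair \<open>(u, c)\<close> stands for the affine form sending \<open>x\<close>
    to \<open>x \<bullet> u + c\<close>.\<close>
  define H where "H = convex_cone hull (f ` insert (0, 1) J)"
  have fin: "finite J" using finite_P by (simp add: J_def)
  have fC: "f j = (- fst j, real (snd j))" if "j \<in> C" for j using that by (simp add: f_def C_def)
  have fF: "f j = (fst j, - real (snd j))" if "j \<in> F" for j
    using that P_nonzero by (auto simp: f_def F_def J_def)
  have J: "J = C \<union> F" "C \<inter> F = {}" by (auto simp: C_def F_def)
  then have finCF: "finite C" "finite F" using fin by auto
  have zero: "(0, 1) \<notin> J" using P_nonzero by (auto simp: J_def)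
  have f0: "f (0, 1) = (0, 1)" by (simp add: f_def)
  have ind_r: "\<alpha> \<in> I r" using ind by (simp add: indecomposable_def chainI_theta)
  have "(- \<alpha>, real r) \<notin> H"
  proof
    assume mem: "(- \<alpha>, real r) \<in> H"
    have "finite (insert (0, 1) J)" using fin by simp
    then obtain c where c: "\<And>j. c j \<ge> 0" and eq: "(- \<alpha>, real r) = (\<Sum>j\<in>insert (0, 1) J. c j *\<^sub>R f j)"
      using mem[unfolded H_def] by (rule convex_cone_hull_finite_image) (rule that)
    have "(\<Sum>j\<in>insert (0, 1) J. c j *\<^sub>R f j) = c (0, 1) *\<^sub>R (0, 1) + ((\<Sum>j\<in>C. c j *\<^sub>R f j) + (\<Sum>j\<in>F. c j *\<^sub>R f j))"
      using zero fin f0 by (simp add: J(1) sum.union_disjoint[OF finCF J(2)])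
    also have "\<dots> = c (0, 1) *\<^sub>R (0, 1) + ((\<Sum>j\<in>C. (- (c j *\<^sub>R fst j), c j * real (snd j))) + (\<Sum>j\<in>F. (c j *\<^sub>R fst j, - (c j * real (snd j)))))"
      by (simp add: fC fF)
    finally have eq2: "(- \<alpha>, real r) = \<dots>" using eq by simp
    have "- \<alpha> = - (\<Sum>j\<in>C. c j *\<^sub>R fst j) + (\<Sum>j\<in>F. c j *\<^sub>R fst j)"
      using arg_cong[OF eq2, of fst] by (simp add: fst_sum sum_negf)
    moreover have "real r = c (0, 1) + ((\<Sum>j\<in>C. c j * real (snd j)) - (\<Sum>j\<in>F. c j * real (snd j)))"
      using arg_cong[OF eq2, of snd] by (simp add: snd_sum sum_negf)
    ultimately have vec: "\<alpha> + (\<Sum>j\<in>F. c j *\<^sub>R fst j) = (\<Sum>j\<in>C. c j *\<^sub>R fst j)"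
      and const: "real r + (\<Sum>j\<in>F. c j * real (snd j)) = c (0, 1) + (\<Sum>j\<in>C. c j * real (snd j))"
      by (auto simp: algebra_simps)
    have "i \<le> k \<and> b \<in> I i \<and> (b, i) \<noteq> (\<alpha>, r)" if "(b, i) \<in> C" for b i
      using that by (auto simp: C_def J_def)
    moreover have "m \<le> k \<and> g \<in> P \<and> g \<notin> I m" if "(g, m) \<in> F" for g m
      using that by (auto simp: F_def J_def)
    ultimately show False
      using no_positive_relation[OF ind al r finCF(1) _ finCF(2) _ c c vec const] by blast
  qed
  moreover have "closed H" unfolding H_def using fin by (simp add: closed_convex_cone_hull)
  moreover have "convex H" unfolding H_def by (rule convex_convex_cone_hull)
  ultimately have "\<exists>zs \<beta>. zs \<bullet> (- \<alpha>, real r) < \<beta> \<and> (\<forall>h\<in>H. zs \<bullet> h > \<beta>)"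
    by (intro separating_hyperplane_closed_point)
  then obtain zs \<beta> where zs: "zs \<bullet> (- \<alpha>, real r) < \<beta>" "\<And>h. h \<in> H \<Longrightarrow> zs \<bullet> h > \<beta>"
    by blast
  obtain z s where zs_eq: "zs = (z, s)" by force
  have "\<beta> < 0" using zs(2)[of 0] by (simp add: H_def convex_cone_hull_contains_0)
  \<comment> \<open>If the value at \<open>h\<close> were negative, the multiple of \<open>h\<close>
    with value exactly \<open>\<beta>\<close> would violate the separation.\<close>
  have nonneg: "zs \<bullet> h \<ge> 0" if "h \<in> H" for h
  proof (rule ccontr)
    assume neg: "\<not> ?thesis"
    define t where "t = \<beta> / (zs \<bullet> h)"
    have "t \<ge> 0" using neg \<open>\<beta> < 0\<close> by (simp add: t_def divide_nonpos_neg)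
    then have "t *\<^sub>R h \<in> H" using that unfolding H_def by (intro convex_cone_hull_mul)
    then have "t * (zs \<bullet> h) > \<beta>" using zs(2)[of "t *\<^sub>R h"] by simp
    then show False using neg by (simp add: t_def)
  qed
  have gen: "zs \<bullet> f j \<ge> 0" if "j \<in> insert (0, 1) J" for j
    using that unfolding H_def[symmetric] by (intro nonneg) (simp only: H_def hull_inc imageI)
  have s: "s \<ge> 0" using gen[of "(0, 1)"] f0 by (simp add: zs_eq inner_Pair)
  obtain x where x: "x \<in> R" using R_nonempty by blast
  \<comment> \<open>In homogeneous coordinates the path is \<open>(x, 1) + t (z, s)\<close>. The
    form \<open>r - \<alpha>\<close> is positive at \<open>(x, 1)\<close> and negative at
    \<open>(z, s)\<close>, and \<open>t\<close> is where it vanishes; the other forms are positive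
    at the start and nonnegative in the direction. Dividing by \<open>1 + t * s\<close> returns to
    affine coordinates.\<close>
  define t where "t = (real r - x \<bullet> \<alpha>) / (z \<bullet> \<alpha> - s * real r)"
  have num: "real r - x \<bullet> \<alpha> > 0" using theta_iff[OF x al r(2)] ind_r by simp
  have den: "z \<bullet> \<alpha> - s * real r > 0" using zs(1) \<open>\<beta> < 0\<close> by (simp add: zs_eq inner_Pair)
  have t: "t > 0" unfolding t_def using num den by simp
  define y where "y = (1 / (1 + t * s)) *\<^sub>R (x + t *\<^sub>R z)"
  have ts: "1 + t * s > 0" using t s by (simp add: add_pos_nonneg)
  have yb: "y \<bullet> b = (x \<bullet> b + t * (z \<bullet> b)) / (1 + t * s)" for b
    by (simp add: y_def inner_left_distrib)
  have "t * (z \<bullet> \<alpha> - s * real r) = real r - x \<bullet> \<alpha>" using den by (simp add: t_def)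
  then have "y \<bullet> \<alpha> = real r" using ts by (simp add: yb field_simps)
  moreover have "if b \<in> I i then y \<bullet> b < real i else y \<bullet> b > real i"
    if b: "b \<in> P" "i \<le> k" "(b, i) \<noteq> (\<alpha>, r)" for b i
  proof (cases "b \<in> I i")
    case True
    then have "(b, i) \<in> C" using b by (auto simp: C_def J_def)
    then have "s * real i - z \<bullet> b \<ge> 0" using gen[of "(b, i)"] fC J(1) by (simp add: zs_eq inner_Pair)
    then have "t * (s * real i - z \<bullet> b) \<ge> 0" using t by simp
    moreover have "x \<bullet> b < real i" using theta_iff[OF x b(1,2)] True by simp
    ultimately have "x \<bullet> b + t * (z \<bullet> b) < real i * (1 + t * s)" by (simp add: algebra_simps)
    then show ?thesis using True ts by (simp add: yb divide_less_eq)
  next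
    case False
    then have "(b, i) \<in> F" using b by (auto simp: F_def J_def)
    then have "z \<bullet> b - s * real i \<ge> 0" using gen[of "(b, i)"] fF J(1) by (simp add: zs_eq inner_Pair)
    then have "t * (z \<bullet> b - s * real i) \<ge> 0" using t by simp
    moreover have "x \<bullet> b > real i" using not_theta_iff[OF x b(1,2)] False by simp
    ultimately have "x \<bullet> b + t * (z \<bullet> b) > real i * (1 + t * s)" by (simp add: algebra_simps)
    then show ?thesis using False ts by (simp add: yb less_divide_eq)
  qed
  ultimately show ?thesis using that by blast
qed

text \<open>The half ball gives the facet; the origin is on the side of \<open>T\<close> because
  \<open>\<alpha>\<close> takes values strictly between 0 and \<open>r\<close> on
  \<open>T\<close>.\<close>

lemma ceiling_from_half_ball:
  assumes al: "\<alpha> \<in> P" and r: "1 \<le> r"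
    and T: "convex T" "T \<subseteq> R" "T \<subseteq> {x. x \<bullet> \<alpha> < real r}"
    and w: "w \<in> hyp \<alpha> (real r)" "d > 0" "ball w d \<inter> {x. x \<bullet> \<alpha> < real r} \<subseteq> T"
    and A: "hyp \<alpha> (real r) \<in> A"
  shows "ceiling A T (hyp \<alpha> (real r))"
proof -
  have "wall A T (hyp \<alpha> (real r))"
    unfolding wall_def using A facet_from_half_ball[OF T(1,3) P_nonzero[OF al] w] by blast
  moreover have "closed_segment 0 x \<inter> hyp \<alpha> (real r) = {}" if "x \<in> T" for x
  proof -
    have "x \<bullet> \<alpha> < real r" "0 < x \<bullet> \<alpha>" using that T P_pos[OF al] by auto
    then have "t * (x \<bullet> \<alpha>) < real r" if "0 \<le> t" "t \<le> 1" for t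
      using mult_right_mono[OF that(2), of "x \<bullet> \<alpha>"] by linarith
    then show ?thesis by (force simp: closed_segment_def hyp_def)
  qed
  ultimately show ?thesis using r by (simp add: ceiling_def hyp_def)
qed

lemma affine_region_convex: "B \<in> regions (affine_arr Phi) \<Longrightarrow> convex B"
  by (rule region_convex) (auto simp: affine_arr_def)

lemma hyp_in_arrs:
  assumes "\<alpha> \<in> P" "r \<le> k"
  shows "hyp \<alpha> (real r) \<in> catalan_arr Phi k" "hyp \<alpha> (real r) \<in> affine_arr Phi"
  using assms P_subset unfolding catalan_arr_def affine_arr_def
  by (auto intro!: exI[of _ \<alpha>] exI[of _ "int r"])

text \<open>A half ball at a generic point of the hyperplane near the wall point lies in
  \<open>R\<close> and meets no affine hyperplane. It thus lies in one alcove and yields a facet of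
  both. \<open>U\<close> witnesses that the alcove has interior.\<close>

lemma indecomposable_imp_ceilings:
  assumes ind: "indecomposable P I k r \<alpha>" and al: "\<alpha> \<in> P" and r: "1 \<le> r" "r \<le> k"
  obtains B U where "B \<in> regions (affine_arr Phi)" "B \<subseteq> R" "open U" "U \<noteq> {}" "U \<subseteq> B"
    "ceiling (catalan_arr Phi k) R (hyp \<alpha> (real r))" "ceiling (affine_arr Phi) B (hyp \<alpha> (real r))"
proof -
  obtain y where y: "y \<bullet> \<alpha> = real r" and yR: "\<And>b i. b \<in> P \<Longrightarrow> i \<le> k \<Longrightarrow> (b, i) \<noteq> (\<alpha>, r) \<Longrightarrow>
      if b \<in> I i then y \<bullet> b < real i else y \<bullet> b > real i"
    using wall_point[OF ind al r] by metis
  have alI: "\<alpha> \<in> I r" using ind by (simp add: indecomposable_def chainI_theta)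
  have finPhi: "finite Phi" using rs by (simp add: root_system_def)
  have al0: "\<alpha> \<noteq> 0" and alPhi: "\<alpha> \<in> Phi" using P_nonzero al P_subset by auto
  obtain x0 where x0: "x0 \<in> R" using R_nonempty by blast
  define E where "E b i = (if b \<in> I i then {x. x \<bullet> b < real i} else {x. x \<bullet> b > real i})" for b i
  have E_open: "open (E b i)" for b i
    using open_halfspace_lt[of b "real i"] open_halfspace_gt[of "real i" b] by (simp add: E_def inner_commute)
  \<comment> \<open>\<open>V\<close> collects all defining inequalities of \<open>R\<close> except
    \<open>\<alpha> < r\<close>.\<close>
  define V where "V = (\<Inter>(b, i) \<in> P \<times> {..k} - {(\<alpha>, r)}. E b i)"
  have "open V" unfolding V_def using finite_P E_open by (intro open_INT) auto
  moreover have "y \<in> E b i" if "b \<in> P" "i \<le> k" "(b, i) \<noteq> (\<alpha>, r)" for b i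
    using yR[OF that] by (simp add: E_def split: if_splits)
  then have "y \<in> V" by (auto simp: V_def)
  ultimately obtain e where e: "e > 0" "ball y e \<subseteq> V" using open_contains_ball by meson
  define Q where "Q = Phi - {\<alpha>, - \<alpha>}"
  define F where "F = hyp \<alpha> (real r) \<inter> ball y e"
  have hyp: "hyp \<alpha> (real r) = {x. \<alpha> \<bullet> x = real r}" by (auto simp: hyp_def inner_commute)
  have yF: "y \<in> F" using y e by (simp add: F_def hyp_def)
  have "aff_dim F = aff_dim (hyp \<alpha> (real r))"
    unfolding F_def using yF by (intro aff_dim_convex_Int_open) (auto simp: hyp convex_hyperplane F_def)
  then have F_dim: "aff_dim F = int DIM('a) - 1" using al0 by (simp add: hyp)
  have "\<not> F \<subseteq> hyp b c" if b: "b \<in> Q" for b c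
  proof
    assume "F \<subseteq> hyp b c"
    moreover have "F \<subseteq> hyp \<alpha> (real r)" "F \<noteq> {}" using yF by (auto simp: F_def)
    ultimately have "(b \<bullet> \<alpha>)\<^sup>2 = (b \<bullet> b) * (\<alpha> \<bullet> \<alpha>)"
      using parallel_hyperplanes[OF al0 _ _ F_dim] by blast
    then show False using root_parallel[OF rs _ alPhi, of b] b by (auto simp: Q_def)
  qed
  moreover have "convex F" unfolding F_def hyp by (intro convex_Int convex_hyperplane convex_ball)
  moreover have "bounded F" unfolding F_def by (simp add: bounded_Int)
  moreover have "finite Q" using finPhi by (simp add: Q_def)
  ultimately obtain w where w: "w \<in> F" "\<forall>b\<in>Q. w \<bullet> b \<notin> \<int>"
    using convex_avoid_integers[of Q F] yF by blast
  have wh: "w \<in> hyp \<alpha> (real r)" using w(1) by (simp add: F_def)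
  \<comment> \<open>\<open>Q\<close> leaves out \<open>\<alpha>\<close>, so its values are
    controlled separately: on the half ball they stay strictly between \<open>r - 1\<close> and
    \<open>r\<close>.\<close>
  have "open (ball y e \<inter> {x. \<alpha> \<bullet> x > real r - 1})" by (intro open_Int open_ball open_halfspace_gt)
  moreover have "w \<in> ball y e \<inter> {x. \<alpha> \<bullet> x > real r - 1}" using w(1) by (auto simp: F_def hyp)
  ultimately obtain d where d: "d > 0" "ball w d \<subseteq> ball y e \<inter> {x. \<alpha> \<bullet> x > real r - 1}"
    "\<And>x b. x \<in> ball w d \<Longrightarrow> b \<in> Q \<Longrightarrow> x \<bullet> b \<notin> \<int>"
    using generic_ball[OF \<open>finite Q\<close> w(2)] by metis
  define U where "U = ball w d \<inter> {x. x \<bullet> \<alpha> < real r}"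
  have L: "{x. x \<bullet> \<alpha> < real r} = {x. \<alpha> \<bullet> x < real r}" by (simp add: inner_commute)
  have U_open: "open U" and U_convex: "convex U"
    unfolding U_def L by (intro open_Int convex_Int open_ball convex_ball open_halfspace_lt convex_halfspace_lt)+
  have "w - (d / (2 * norm \<alpha>)) *\<^sub>R \<alpha> \<in> U"
    using d(1) al0 wh by (simp add: U_def hyp_def dist_norm inner_diff_left)
  then have U_ne: "U \<noteq> {}" by blast
  have UR: "U \<subseteq> R"
  proof
    fix u assume u: "u \<in> U"
    then have uV: "u \<in> V" using d(2) e(2) by (auto simp: U_def)
    show "u \<in> R"
    proof (rule mem_R[OF x0])
      fix b i assume b: "b \<in> P" "i \<le> k"
      have "u \<in> E b i"
      proof (cases "(b, i) = (\<alpha>, r)")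
        case True
        then show ?thesis using u alI by (simp add: U_def E_def)
      next
        case False
        then show ?thesis using uV b unfolding V_def by auto
      qed
      then show "if b \<in> I i then u \<bullet> b < real i else u \<bullet> b > real i"
        by (simp add: E_def split: if_splits)
    qed
  qed
  have U_int: "u \<bullet> b \<notin> \<int>" if u: "u \<in> U" and b: "b \<in> Phi" for u b
  proof -
    have al_int: "u \<bullet> \<alpha> \<notin> \<int>"
    proof
      assume "u \<bullet> \<alpha> \<in> \<int>"
      then obtain m :: int where "u \<bullet> \<alpha> = of_int m" by (auto elim: Ints_cases)
      moreover have "real r - 1 < u \<bullet> \<alpha>" "u \<bullet> \<alpha> < real r"
        using u d(2) by (auto simp: U_def inner_commute)
      ultimately have "int r - 1 < m" "m < int r" by linarith+
      then show False by simp
    qed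
    consider "b \<in> Q" | "b = \<alpha>" | "b = - \<alpha>" using b by (auto simp: Q_def)
    then show ?thesis using d(3)[of u b] u al_int by cases (auto simp: U_def)
  qed
  obtain B where B: "B \<in> regions (affine_arr Phi)" "U \<subseteq> B" "B \<subseteq> R"
    using alcove_exists[OF U_convex U_ne UR U_int] by blast
  have Rlt: "R \<subseteq> {x. x \<bullet> \<alpha> < real r}" using alI by (auto simp: theta_def)
  have "ceiling (catalan_arr Phi k) R (hyp \<alpha> (real r))"
    by (rule ceiling_from_half_ball[OF al r(1) R_convex order_refl Rlt wh d(1) _ hyp_in_arrs(1)[OF al r(2)]])
      (use UR in \<open>simp add: U_def\<close>)
  moreover have "ceiling (affine_arr Phi) B (hyp \<alpha> (real r))"
    by (rule ceiling_from_half_ball[OF al r(1) affine_region_convex[OF B(1)] B(3) _ wh d(1) _ hyp_in_arrs(2)[OF al r(2)]])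
      (use B Rlt in \<open>auto simp: U_def\<close>)
  ultimately show ?thesis using that[OF B(1,3) U_open U_ne B(2)] by blast
qed

text \<open>Supplies the alcove when \<open>\<alpha>\<close> is indecomposable of no rank from 1 to
  \<open>k\<close>.\<close>

lemma alcove_in_R:
  obtains B U where "B \<in> regions (affine_arr Phi)" "B \<subseteq> R" "open U" "U \<noteq> {}" "U \<subseteq> B"
proof -
  obtain x e where e: "e > 0" "ball x e \<subseteq> R" using R_nonempty R_open open_contains_ball by (metis ex_in_conv)
  have finPhi: "finite Phi" and nz: "0 \<notin> Phi" using rs by (auto simp: root_system_def)
  have "\<not> ball x e \<subseteq> hyp b c" if "b \<in> Phi" for b c
  proof
    assume "ball x e \<subseteq> hyp b c"
    then have "aff_dim (ball x e) \<le> aff_dim {z. b \<bullet> z = c}"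
      by (intro aff_dim_subset) (auto simp: hyp_def inner_commute)
    moreover have "b \<noteq> 0" using that nz by auto
    ultimately show False using e(1) by (simp add: aff_dim_open)
  qed
  then obtain w where w: "w \<in> ball x e" "\<forall>b\<in>Phi. w \<bullet> b \<notin> \<int>"
    using convex_avoid_integers[OF finPhi convex_ball _ bounded_ball] e(1) by (metis ball_eq_empty not_less)
  obtain d where d: "d > 0" "ball w d \<subseteq> ball x e" "\<And>z b. z \<in> ball w d \<Longrightarrow> b \<in> Phi \<Longrightarrow> z \<bullet> b \<notin> \<int>"
    using generic_ball[OF finPhi w(2) open_ball w(1)] by metis
  then obtain B where "B \<in> regions (affine_arr Phi)" "ball w d \<subseteq> B" "B \<subseteq> R"
    using alcove_exists[of "ball w d"] e(2) by (metis ball_eq_empty convex_ball not_less order_trans)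
  then show ?thesis using that[of B "ball w d"] d(1) by auto
qed

lemma indecomposable_rank_unique:
  "indecomposable P I k r \<alpha> \<Longrightarrow> indecomposable P I k r' \<alpha> \<Longrightarrow> r = r'"
  unfolding indecomposable_def by auto

end

section \<open>The three equivalent conditions\<close>

theorem theorem4:
  fixes Phi S :: "'a::euclidean_space set" and k :: nat and R :: "'a set" and \<alpha> :: 'a
  assumes "root_system Phi" and "crystallographic Phi" and "irreducible_rs Phi"
    and "simple_system Phi S"
    and "0 < k"
    and "R \<in> regions (catalan_arr Phi k)" and "dominant (pos_roots Phi S) R"
    and "\<alpha> \<in> pos_roots Phi S"
  shows "\<exists>B \<in> regions (affine_arr Phi). B \<subseteq> R \<and>
     (\<forall>r\<in>{1..k}.
        (ceiling (catalan_arr Phi k) R (hyp \<alpha> (real r)) \<longleftrightarrow>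
           indecomposable (pos_roots Phi S) (theta (pos_roots Phi S) R) k r \<alpha>) \<and>
        (indecomposable (pos_roots Phi S) (theta (pos_roots Phi S) R) k r \<alpha> \<longleftrightarrow>
           ceiling (affine_arr Phi) B (hyp \<alpha> (real r))))"
proof -
  interpret dominant_region Phi S k R using assms by unfold_locales
  note al = assms(8)
  \<comment> \<open>\<open>B\<close> has to be fixed before \<open>r\<close>. The rank clause admits
    at most one \<open>r\<close>, so the alcove built for that rank, or any alcove of
    \<open>R\<close> if there is none, serves all \<open>r\<close>.\<close>
  obtain B U where B: "B \<in> regions (affine_arr Phi)" "B \<subseteq> R" and U: "open U" "U \<noteq> {}" "U \<subseteq> B"
    and ceil: "\<And>r. r \<in> {1..k} \<Longrightarrow> indecomposable P I k r \<alpha> \<Longrightarrow>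
      ceiling (catalan_arr Phi k) R (hyp \<alpha> (real r)) \<and> ceiling (affine_arr Phi) B (hyp \<alpha> (real r))"
  proof (cases "\<exists>r\<in>{1..k}. indecomposable P I k r \<alpha>")
    case True
    then obtain r where r: "1 \<le> r" "r \<le> k" "indecomposable P I k r \<alpha>" by auto
    obtain B U where "B \<in> regions (affine_arr Phi)" "B \<subseteq> R" "open U" "U \<noteq> {}" "U \<subseteq> B"
      "ceiling (catalan_arr Phi k) R (hyp \<alpha> (real r))" "ceiling (affine_arr Phi) B (hyp \<alpha> (real r))"
      by (rule indecomposable_imp_ceilings[OF r(3) al r(1,2)])
    then show ?thesis using that[of B U] indecomposable_rank_unique[OF r(3)] by blast
  next
    case False
    obtain B U where "B \<in> regions (affine_arr Phi)" "B \<subseteq> R" "open U" "U \<noteq> {}" "U \<subseteq> B"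
      by (rule alcove_in_R)
    then show ?thesis using that[of B U] False by blast
  qed
  have "indecomposable P I k r \<alpha>"
    if "r \<in> {1..k}" "ceiling (catalan_arr Phi k) R (hyp \<alpha> (real r))" for r
    using ceiling_imp_indecomposable[OF al _ _ order_refl R_open R_nonempty order_refl that(2)] that(1) by simp
  moreover have "indecomposable P I k r \<alpha>"
    if "r \<in> {1..k}" "ceiling (affine_arr Phi) B (hyp \<alpha> (real r))" for r
    using ceiling_imp_indecomposable[OF al _ _ B(2) U that(2)] that(1) by simp
  ultimately show ?thesis using B ceil by blast
qed

end
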